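(* Let $f(q)=q+\sum_{k=2}^{\infty}q^kp_k\in\mathcal{C}$ (with $p_k\in\mathbb{H}$) be a slice close-to-convex function on $\mathbb{B}$. Then $$|q|+\sum_{k=2}^{\infty}|q^kp_k|\leq 1\quad\text{for all } q\in\mathbb{B}\text{ with } |q|\leq \frac{3-\sqrt{5}}{2}.$$ The constant $(3-\sqrt{5})/2$ cannot be improved, i.e. it cannot be replaced by any larger number so that the inequality remains true for all such $f$.
   Context: $\mathbb{H}$ is the skew field of quaternions with its usual modulus $|\cdot|$ and real part $\mathrm{Re}$; $\mathbb{B}=\{q\in\mathbb{H}:|q|<1\}$. Let $\mathbb{S}=\{q\in\mathbb{H}:q^2=-1\}$ and, for $I\in\mathbb{S}$, $\mathbb{C}_I=\mathbb{R}\oplus I\mathbb{R}$ and $\mathbb{B}_I=\mathbb{B}\cap\mathbb{C}_I$. A function $f:\mathbb{B}\to\mathbb{H}$ is (left) slice regular if for every $I\in\mathbb{S}$ its restriction $f_I$ to $\mathbb{B}_I$ has continuous partial derivatives and satisfies $\frac12\left(\frac{\partial}{\partial x}+I\frac{\partial}{\partial y}\right)f_I(x+yI)=0$ for all $x+yI\in\mathbb{B}_I$. Every slice regular $f$ on $\mathbb{B}$ has a power series expansion $f(q)=\sum_{k=0}^\infty q^kp_k$ on $\mathbb{B}$ with $p_k\in\mathbb{H}$. The slice derivative $f'$ is defined on each $\mathbb{B}_I$ by $f'(x+yI)=\frac12\left(\frac{\partial}{\partial x}-I\frac{\partial}{\partial y}\right)f_I(x+yI)$. $\mathcal{S}$ denotes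 the class of slice regular functions $h$ on $\mathbb{B}$ with $h(0)=0$, $h'(0)=1$, and whose zero set in $\mathbb{B}$ is exactly $\{0\}$. The class of slice starlike functions is $$\mathcal{S}^*=\{h\in\mathcal{S}:\ \mathrm{Re}\left(h(q)^{-1}qh'(q)\right)>0\ \text{on}\ \mathbb{B}\}.$$ The class $\mathcal{C}$ of slice close-to-convex functions consists of the slice regular functions $f:\mathbb{B}\to\mathbb{H}$ for which there exists $h\in\mathcal{S}^*$ such that $\mathrm{Re}\left(h(q)^{-1}qf'(q)\right)>0$ on $\mathbb{B}$. At $q=0$ the expressions $h(q)^{-1}qh'(q)$ and $h(q)^{-1}qf'(q)$ are understood as their limits, $1$ and $f'(0)$ respectively. *)

theory Defs
  imports "HOL-Analysis.Analysis"
begin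

codatatype quat = Quat (qRe: real) (qI: real) (qJ: real) (qK: real)

lemma quat_eqI [intro?]:
  "qRe x = qRe y \<Longrightarrow> qI x = qI y \<Longrightarrow> qJ x = qJ y \<Longrightarrow> qK x = qK y \<Longrightarrow> x = y"
  by (rule quat.expand) simp

lemma quat_eq_iff: "x = y \<longleftrightarrow> qRe x = qRe y \<and> qI x = qI y \<and> qJ x = qJ y \<and> qK x = qK y"
  by (auto intro: quat.expand)

instantiation quat :: ab_group_add
begin

primcorec zero_quat where
  "qRe 0 = 0" | "qI 0 = 0" | "qJ 0 = 0" | "qK 0 = 0"

primcorec plus_quat where
  "qRe (x + y) = qRe x + qRe y"
| "qI (x + y) = qI x + qI y"
| "qJ (x + y) = qJ x + qJ y"
| "qK (x + y) = qK x + qK y"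

primcorec uminus_quat where
  "qRe (- x) = - qRe x"
| "qI (- x) = - qI x"
| "qJ (- x) = - qJ x"
| "qK (- x) = - qK x"

primcorec minus_quat where
  "qRe (x - y) = qRe x - qRe y"
| "qI (x - y) = qI x - qI y"
| "qJ (x - y) = qJ x - qJ y"
| "qK (x - y) = qK x - qK y"

instance
  by standard (simp_all add: quat_eq_iff)

end

instantiation quat :: ring_1
begin

primcorec one_quat where
  "qRe 1 = 1" | "qI 1 = 0" | "qJ 1 = 0" | "qK 1 = 0"

primcorec times_quat where
  "qRe (x * y) = qRe x * qRe y - qI x * qI y - qJ x * qJ y - qK x * qK y"
| "qI (x * y) = qRe x * qI y + qI x * qRe y + qJ x * qK y - qK x * qJ y"
| "qJ (x * y) = qRe x * qJ y - qI x * qK y + qJ x * qRe y + qK x * qI y"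
| "qK (x * y) = qRe x * qK y + qI x * qJ y - qJ x * qI y + qK x * qRe y"

instance
  by standard (simp_all add: quat_eq_iff algebra_simps)

end

instantiation quat :: real_algebra_1
begin

primcorec scaleR_quat where
  "qRe (scaleR r x) = r * qRe x"
| "qI (scaleR r x) = r * qI x"
| "qJ (scaleR r x) = r * qJ x"
| "qK (scaleR r x) = r * qK x"

instance
  by standard (simp_all add: quat_eq_iff algebra_simps)

end

instantiation quat :: real_inner
begin

definition inner_quat :: "quat \<Rightarrow> quat \<Rightarrow> real" where
  "inner_quat x y = qRe x * qRe y + qI x * qI y + qJ x * qJ y + qK x * qK y"

definition norm_quat :: "quat \<Rightarrow> real" where
  "norm_quat x = sqrt ((qRe x)\<^sup>2 + (qI x)\<^sup>2 + (qJ x)\<^sup>2 + (qK x)\<^sup>2)"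

definition sgn_quat :: "quat \<Rightarrow> quat" where
  "sgn_quat x = x /\<^sub>R norm x"

definition dist_quat :: "quat \<Rightarrow> quat \<Rightarrow> real" where
  "dist_quat x y = norm (x - y)"

definition uniformity_quat :: "(quat \<times> quat) filter" where
  [code del]: "uniformity_quat = (INF e\<in>{0<..}. principal {(x, y). dist x y < e})"

definition open_quat :: "quat set \<Rightarrow> bool" where
  [code del]: "open_quat U \<longleftrightarrow> (\<forall>x\<in>U. eventually (\<lambda>(x', y). x' = x \<longrightarrow> y \<in> U) uniformity)"

instance
proof
  fix x y z :: quat and r :: real and U :: "quat set"
  show "dist x y = norm (x - y)" by (rule dist_quat_def)
  show "sgn x = x /\<^sub>R norm x" by (rule sgn_quat_def)
  show "uniformity = (INF e\<in>{0<..}. principal {(x::quat, y). dist x y < e})"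
    by (rule uniformity_quat_def)
  show "open U \<longleftrightarrow> (\<forall>x\<in>U. eventually (\<lambda>(x', y). x' = x \<longrightarrow> y \<in> U) uniformity)"
    by (rule open_quat_def)
  show "inner x y = inner y x" by (simp add: inner_quat_def mult.commute)
  show "inner (x + y) z = inner x z + inner y z" by (simp add: inner_quat_def algebra_simps)
  show "inner (scaleR r x) y = r * inner x y" by (simp add: inner_quat_def algebra_simps)
  show "0 \<le> inner x x" by (simp add: inner_quat_def)
  show "inner x x = 0 \<longleftrightarrow> x = 0"
    by (auto simp: inner_quat_def quat_eq_iff add_nonneg_eq_0_iff)
  show "norm x = sqrt (inner x x)" by (simp add: inner_quat_def norm_quat_def power2_eq_square)
qed

end

instantiation quat :: real_normed_div_algebra
begin

definition inverse_quat :: "quat \<Rightarrow> quat" where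
  "inverse_quat x = Quat (qRe x) (- qI x) (- qJ x) (- qK x) /\<^sub>R (norm x)\<^sup>2"

definition divide_quat :: "quat \<Rightarrow> quat \<Rightarrow> quat" where
  "divide_quat x y = x * inverse y"

instance
proof
  fix x y :: quat
  show "x div y = x * inverse y" by (rule divide_quat_def)
  show "inverse (0::quat) = 0" by (simp add: inverse_quat_def)
  show "norm (x * y) = norm x * norm y"
    unfolding norm_quat_def real_sqrt_mult [symmetric]
    by (rule arg_cong [where f = sqrt]) (simp add: power2_eq_square algebra_simps)
  let ?c = "Quat (qRe x) (- qI x) (- qJ x) (- qK x)"
  have c: "?c * x = (norm x)\<^sup>2 *\<^sub>R 1" "x * ?c = (norm x)\<^sup>2 *\<^sub>R 1"
    by (simp_all add: quat_eq_iff norm_quat_def power2_eq_square mult.commute)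
  assume "x \<noteq> 0"
  then show "inverse x * x = 1" "x * inverse x = 1"
    by (simp_all add: inverse_quat_def c)
qed

end

instantiation quat :: euclidean_space
begin

definition Basis_quat :: "quat set" where
  "Basis_quat = {Quat 1 0 0 0, Quat 0 1 0 0, Quat 0 0 1 0, Quat 0 0 0 1}"

instance
proof
  show "(Basis :: quat set) \<noteq> {}" "finite (Basis :: quat set)"
    by (simp_all add: Basis_quat_def)
  show "inner u v = (if u = v then 1 else 0)" if "u \<in> Basis" "v \<in> Basis" for u v :: quat
    using that unfolding Basis_quat_def by (elim insertE emptyE) (simp_all add: inner_quat_def)
  show "(\<forall>u\<in>Basis. inner x u = 0) \<longleftrightarrow> x = 0" for x :: quat
    by (simp add: Basis_quat_def inner_quat_def quat_eq_iff [of x])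
qed

end

definition quat_ball :: "quat set" where
  "quat_ball = {q. norm q < 1}"

definition imag_units :: "quat set" where
  "imag_units = {q. q\<^sup>2 = - 1}"

definition slice_pt :: "quat \<Rightarrow> real \<Rightarrow> real \<Rightarrow> quat" where
  "slice_pt I x y = of_real x + of_real y * I"

text \<open>A function on the ball is represented by a total function on the quaternions; all
  notions below depend only on its values on the (open) ball.\<close>

definition slice_dx :: "(quat \<Rightarrow> quat) \<Rightarrow> quat \<Rightarrow> real \<Rightarrow> real \<Rightarrow> quat" where
  "slice_dx f I x y = vector_derivative (\<lambda>s. f (slice_pt I s y)) (at x)"

definition slice_dy :: "(quat \<Rightarrow> quat) \<Rightarrow> quat \<Rightarrow> real \<Rightarrow> real \<Rightarrow> quat" where
  "slice_dy f I x y = vector_derivative (\<lambda>t. f (slice_pt I x t)) (at y)"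

definition slice_regular :: "(quat \<Rightarrow> quat) \<Rightarrow> bool" where
  "slice_regular f \<longleftrightarrow> (\<forall>I\<in>imag_units.
     (\<forall>x y. slice_pt I x y \<in> quat_ball \<longrightarrow>
        (\<lambda>s. f (slice_pt I s y)) differentiable at x \<and>
        (\<lambda>t. f (slice_pt I x t)) differentiable at y) \<and>
     continuous_on {(x, y). slice_pt I x y \<in> quat_ball} (\<lambda>(x, y). slice_dx f I x y) \<and>
     continuous_on {(x, y). slice_pt I x y \<in> quat_ball} (\<lambda>(x, y). slice_dy f I x y) \<and>
     (\<forall>x y. slice_pt I x y \<in> quat_ball \<longrightarrow>
        (1 / 2) *\<^sub>R (slice_dx f I x y + I * slice_dy f I x y) = 0))"

text \<open>A point has several representations \<open>x + y I\<close> (infinitely many if it is real), so the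
  defining formula has to be independent of the representation; for slice regular functions
  it is, see \<open>slice_deriv_eq\<close>.\<close>

definition slice_deriv :: "(quat \<Rightarrow> quat) \<Rightarrow> quat \<Rightarrow> quat" where
  "slice_deriv f q = (THE d. \<forall>I\<in>imag_units. \<forall>x y. q = slice_pt I x y \<longrightarrow>
     d = (1 / 2) *\<^sub>R (slice_dx f I x y - I * slice_dy f I x y))"

lemma imag_units_qRe: assumes "I \<in> imag_units" shows "qRe I = 0"
proof -
  have *: "qRe I * qRe I - qI I * qI I - qJ I * qJ I - qK I * qK I = -1"
      "qRe I * qI I = 0" "qRe I * qJ I = 0" "qRe I * qK I = 0"
    using assms by (auto simp: imag_units_def power2_eq_square quat_eq_iff algebra_simps)
  show ?thesis
  proof (rule ccontr)
    assume "qRe I \<noteq> 0"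
    with * have "qRe I * qRe I = -1" by simp
    then show False by (metis zero_le_square not_one_le_zero neg_0_le_iff_le)
  qed
qed

lemma imag_units_square: "I \<in> imag_units \<Longrightarrow> I * I = - 1"
  by (simp add: imag_units_def power2_eq_square)

lemma imag_units_exists: "\<exists>I\<in>imag_units. \<exists>x y. q = slice_pt I x y"
proof (cases "q = of_real (qRe q)")
  case True
  have "Quat 0 1 0 0 \<in> imag_units" by (simp add: imag_units_def power2_eq_square quat_eq_iff)
  moreover from True have "q = slice_pt (Quat 0 1 0 0) (qRe q) 0" by (simp add: slice_pt_def)
  ultimately show ?thesis by blast
next
  case False
  define v where "v = q - of_real (qRe q)"
  have v: "v \<noteq> 0" "qRe v = 0" using False by (auto simp: v_def of_real_def)
  define I where "I = v /\<^sub>R norm v"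
  have "v * v = - of_real ((norm v)\<^sup>2)"
    using v(2) by (simp add: quat_eq_iff norm_quat_def of_real_def power2_eq_square)
  then have "I * I = - ((inverse (norm v) * inverse (norm v) * (norm v)\<^sup>2) *\<^sub>R 1)"
    by (simp add: I_def of_real_def)
  also have "inverse (norm v) * inverse (norm v) * (norm v)\<^sup>2 = 1"
    using v(1) by (simp add: power2_eq_square field_simps)
  finally have "I * I = - 1" by simp
  then have "I \<in> imag_units" by (simp add: imag_units_def power2_eq_square)
  moreover have "q = slice_pt I (qRe q) (norm v)"
    using v(1) by (simp add: slice_pt_def I_def v_def of_real_def)
  ultimately show ?thesis by blast
qed

lemma slice_deriv_eq_dx:
  assumes f: "slice_regular f" and I: "I \<in> imag_units" and xy: "slice_pt I x y \<in> quat_ball"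
  shows "(1 / 2) *\<^sub>R (slice_dx f I x y - I * slice_dy f I x y) = slice_dx f I x y"
proof -
  have "slice_dx f I x y + I * slice_dy f I x y = 0"
    using assms by (auto simp: slice_regular_def)
  then have "slice_dx f I x y - I * slice_dy f I x y = 2 *\<^sub>R slice_dx f I x y"
    by (simp add: eq_neg_iff_add_eq_0 [symmetric] scaleR_2)
  then show ?thesis by simp
qed

lemma slice_deriv_eq:
  assumes f: "slice_regular f" and I: "I \<in> imag_units" and q: "slice_pt I x y \<in> quat_ball"
  shows "slice_deriv f (slice_pt I x y) = (1 / 2) *\<^sub>R (slice_dx f I x y - I * slice_dy f I x y)"
  unfolding slice_deriv_def
proof (rule the_equality)
  show "\<forall>J\<in>imag_units. \<forall>u v. slice_pt I x y = slice_pt J u v \<longrightarrow>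
      (1 / 2) *\<^sub>R (slice_dx f I x y - I * slice_dy f I x y) =
      (1 / 2) *\<^sub>R (slice_dx f J u v - J * slice_dy f J u v)"
  proof (intro ballI allI impI)
    fix J u v assume J: "J \<in> imag_units" and eq: "slice_pt I x y = slice_pt J u v"
    have "qRe (slice_pt I x y) = qRe (slice_pt J u v)" using eq by simp
    then have "x = u"
      by (simp add: slice_pt_def of_real_def imag_units_qRe [OF I] imag_units_qRe [OF J])
    moreover with eq have "of_real y * I = of_real v * J" by (simp add: slice_pt_def)
    ultimately have "slice_dx f I x y = slice_dx f J u v"
      by (simp add: slice_dx_def slice_pt_def)
    then show "(1 / 2) *\<^sub>R (slice_dx f I x y - I * slice_dy f I x y) =
        (1 / 2) *\<^sub>R (slice_dx f J u v - J * slice_dy f J u v)"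
      using slice_deriv_eq_dx [OF f I q] slice_deriv_eq_dx [OF f J q [unfolded eq]] by simp
  qed
qed (use I in blast)

definition normalized_slice :: "(quat \<Rightarrow> quat) set" where
  "normalized_slice = {h. slice_regular h \<and> h 0 = 0 \<and> slice_deriv h 0 = 1 \<and>
     {q \<in> quat_ball. h q = 0} = {0}}"

text \<open>The expression \<open>h(q)\<^sup>-\<^sup>1 q f'(q)\<close>; for \<open>h\<close> in the normalized class it extends to \<open>q = 0\<close>
  with the limit \<open>f'(0)\<close>, which has to be put in explicitly because \<open>inverse 0 = 0\<close>.\<close>

definition slice_quotient :: "(quat \<Rightarrow> quat) \<Rightarrow> (quat \<Rightarrow> quat) \<Rightarrow> quat \<Rightarrow> quat" where
  "slice_quotient h f q =
     (if q = 0 then slice_deriv f 0 else inverse (h q) * q * slice_deriv f q)"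

definition slice_starlike :: "(quat \<Rightarrow> quat) set" where
  "slice_starlike = {h \<in> normalized_slice. \<forall>q\<in>quat_ball. qRe (slice_quotient h h q) > 0}"

definition slice_close_to_convex :: "(quat \<Rightarrow> quat) set" where
  "slice_close_to_convex = {f. slice_regular f \<and>
     (\<exists>h\<in>slice_starlike. \<forall>q\<in>quat_ball. qRe (slice_quotient h f q) > 0)}"

definition has_normalized_expansion :: "(quat \<Rightarrow> quat) \<Rightarrow> (nat \<Rightarrow> quat) \<Rightarrow> bool" where
  "has_normalized_expansion f p \<longleftrightarrow>
     (\<forall>q\<in>quat_ball. (\<lambda>k. q ^ (k + 2) * p (k + 2)) sums (f q - q))"

text \<open>The summability conjunct rules out divergent series, for which \<open>suminf\<close> is unspecified.\<close>

definition bohr_inequality :: "(nat \<Rightarrow> quat) \<Rightarrow> quat \<Rightarrow> bool" where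
  "bohr_inequality p q \<longleftrightarrow>
     summable (\<lambda>k. norm (q ^ (k + 2) * p (k + 2))) \<and>
     norm q + (\<Sum>k. norm (q ^ (k + 2) * p (k + 2))) \<le> 1"

end

theory Submission
  imports Defs "HOL-Complex_Analysis.Complex_Analysis"
begin

text \<open>
  The inequality follows from the bound \<open>|p\<^sub>k| \<le> k\<close>, since
  \<open>\<Sum>\<^sub>k k r\<^sup>k = r / (1 - r)\<^sup>2\<close> is at most \<open>1\<close> exactly for \<open>r \<le> (3 - \<surd>5) / 2\<close>; the Koebe function
  \<open>q (1 - q)\<^sup>-\<^sup>2\<close> shows sharpness.

  For the bound, write the power series of \<open>h(q) / q\<close> and \<open>f'\<close> as quadruples \<open>\<alpha>\<close>, \<open>\<beta>\<close> of holomorphic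
  functions on the disc, that is, with values in the biquaternions \<open>\<complex> \<otimes> \<H>\<close>. The value at \<open>x + y I\<close>
  is obtained by sending the central imaginary unit to \<open>I\<close>, acting from the left. The regular
  quotient \<open>P = \<alpha>\<^sup>-\<^sup>1 \<beta>\<close> takes at \<open>x + y I\<close> the value of the pointwise quotient \<open>h(q)\<^sup>-\<^sup>1 q f'(q)\<close> at a
  conjugate point \<open>q = x + y J\<close>, hence it has positive real part, and Caratheodory's lemma gives
  \<open>|P\<^sub>n| \<le> 2\<close>. Comparing coefficients in \<open>f' = (h / q) * P\<close> bounds first the coefficients of the
  starlike function (take \<open>f = h\<close>) and then those of \<open>f\<close>.\<close>

section \<open>Caratheodory's coefficient bound\<close>

text \<open>On a circle of radius \<open>r < 1\<close> the Fourier coefficient of \<open>f\<close>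
  of index \<open>- n\<close> vanishes. Adding its conjugate to the \<open>n\<close>-th one replaces
  \<open>f\<close> by \<open>2 * Re f\<close>, which is positive and has mean
  \<open>2 * Re (f 0)\<close>. The triangle inequality for integrals gives the bound up to a factor
  \<open>r ^ n\<close>.\<close>

lemma Caratheodory_coeff_bound:
  fixes f :: "complex \<Rightarrow> complex"
  assumes hol: "f holomorphic_on ball 0 1"
    and pos: "\<And>z. z \<in> ball 0 1 \<Longrightarrow> 0 < Re (f z)"
    and n: "0 < n"
  shows "norm ((deriv ^^ n) f 0 / fact n) \<le> 2 * Re (f 0)"
proof -
  define c where "c = (deriv ^^ n) f 0 / fact n"
  have bound: "norm c * r ^ n \<le> 2 * Re (f 0)" if r: "0 < r" "r < 1" for r
  proof -
    define u where "u = circlepath 0 r"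
    have sub: "cball 0 r \<subseteq> ball (0::complex) 1" using r by auto
    have cont: "continuous_on (cball 0 r) f"
      using hol sub holomorphic_on_imp_continuous_on continuous_on_subset by blast
    have holr: "f holomorphic_on ball 0 r"
      using hol sub ball_subset_cball holomorphic_on_subset by (metis order_trans)
    have u: "u t = of_real r * exp (2 * of_real pi * \<i> * of_real t)" for t
      by (simp add: u_def circlepath)
    have u0: "u t \<noteq> 0" for t using r by (simp add: u)
    have nu: "norm (u t) = r" for t using r by (simp add: u norm_mult)
    have uin: "u t \<in> ball 0 1" for t using nu r by simp
    have vd: "vector_derivative u (at t within {0..1}) = 2 * pi * \<i> * u t" if "t \<in> {0..1}" for t
      unfolding u_def using that by (subst vector_derivative_circlepath01) (auto simp: circlepath)
    \<comment> \<open>Dividing by \<open>2 * pi * \<i>\<close> turns contour integrals into means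
      over the parameter interval; \<open>i\<close> is a variable for the value, not the imaginary
      unit.\<close>
    have conv: "((\<lambda>t. g (u t) * u t) has_integral i) {0..1}"
      if "(g has_contour_integral (2 * pi * \<i> * i)) u" for g i
    proof -
      have "((\<lambda>t. g (u t) * (2 * pi * \<i> * u t)) has_integral 2 * pi * \<i> * i) {0..1}"
        using that unfolding has_contour_integral_def
        by (rule has_integral_eq [rotated]) (simp add: vd)
      from has_integral_mult_right [OF this, of "1 / (2 * pi * \<i>)"] show ?thesis
        by (simp add: field_simps)
    qed
    have pos_coeff: "((\<lambda>t. f (u t) / u t ^ m) has_integral (deriv ^^ m) f 0 / fact m) {0..1}" for m
    proof -
      have "((\<lambda>z. f z / (z - 0) ^ Suc m) has_contour_integral
          (2 * pi * \<i> * ((deriv ^^ m) f 0 / fact m))) u"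
        unfolding u_def
        using Cauchy_has_contour_integral_higher_derivative_circlepath [OF cont holr, of 0 m] r
        by (simp add: field_simps)
      from conv [OF this] show ?thesis using u0 by simp
    qed
    \<comment> \<open>One factor \<open>u t\<close> comes from the derivative of the circle, so
      Cauchy's theorem is applied with the exponent \<open>n - 1\<close>; this uses
      \<open>0 < n\<close>.\<close>
    have "((\<lambda>t. f (u t) * u t ^ n) has_integral 0) {0..1}"
    proof -
      have "((\<lambda>z. f z * z ^ (n - 1)) has_contour_integral 0) u"
      proof (rule Cauchy_theorem_disc_simple [where a = 0 and e = 1])
        show "(\<lambda>z. f z * z ^ (n - 1)) holomorphic_on ball 0 1"
          by (intro holomorphic_intros hol)
      qed (use r in \<open>auto simp: u_def\<close>)
      with conv [of "\<lambda>z. f z * z ^ (n - 1)" 0]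
      have "((\<lambda>t. f (u t) * u t ^ (n - 1) * u t) has_integral 0) {0..1}" by simp
      then show ?thesis using n by (cases n) (simp_all add: mult_ac)
    qed
    then have "((\<lambda>t. cnj (f (u t) * u t ^ n) / of_real (r ^ (2 * n))) has_integral
        cnj 0 / of_real (r ^ (2 * n))) {0..1}"
      by (intro has_integral_divide) (rule has_integral_linear [OF _ bounded_linear_cnj, unfolded o_def])
    \<comment> \<open>On the circle the conjugate of \<open>u t\<close> is
      \<open>r ^ 2 / u t\<close>, so conjugation turns the factor \<open>u t ^ n\<close> into a
      denominator.\<close>
    moreover have "cnj (f (u t) * u t ^ n) / of_real (r ^ (2 * n)) = cnj (f (u t)) / u t ^ n" for t
    proof -
      have "cnj (u t) * u t = of_real (r ^ 2)"
        using complex_norm_square [of "u t"] nu by (simp add: mult.commute)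
      then have "cnj (u t) ^ n * u t ^ n = of_real (r ^ (2 * n))"
        by (simp add: power_mult flip: power_mult_distrib)
      then show ?thesis using u0 [of t] r by (simp add: field_simps)
    qed
    ultimately have "((\<lambda>t. cnj (f (u t)) / u t ^ n) has_integral 0) {0..1}" by simp
    from has_integral_add [OF pos_coeff [of n] this]
    have 1: "((\<lambda>t. of_real (2 * Re (f (u t))) / u t ^ n) has_integral c) {0..1}"
      by (simp add: c_def complex_add_cnj flip: add_divide_distrib)
    have "((\<lambda>t. Re (f (u t))) has_integral Re (f 0)) {0..1}"
      using has_integral_Re [OF pos_coeff [of 0]] by simp
    from has_integral_mult_right [OF this, of "2 / r ^ n"]
    have 2: "((\<lambda>t. 2 / r ^ n * Re (f (u t))) has_integral 2 / r ^ n * Re (f 0)) {0..1}" .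
    have "norm c \<le> 2 / r ^ n * Re (f 0)"
      unfolding integral_unique [OF 1, symmetric] integral_unique [OF 2, symmetric]
    proof (rule integral_norm_bound_integral)
      fix t :: real
      show "norm (of_real (2 * Re (f (u t))) / u t ^ n) \<le> 2 / r ^ n * Re (f (u t))"
        using pos [OF uin [of t]] by (simp add: norm_divide norm_power nu)
    qed (use 1 2 in blast)+
    then show ?thesis using r by (simp add: field_simps)
  qed
  \<comment> \<open>Letting \<open>r\<close> tend to 1 removes the factor
    \<open>r ^ n\<close>.\<close>
  have "((\<lambda>r. norm c * r ^ n) \<longlongrightarrow> norm c * 1 ^ n) (at_left 1)"
    by (intro tendsto_intros)
  moreover have "\<forall>\<^sub>F r in at_left 1. norm c * r ^ n \<le> 2 * Re (f 0)"
    using eventually_at_left_real [OF zero_less_one]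
    by (rule eventually_mono) (use bound in auto)
  ultimately have "norm c * 1 ^ n \<le> 2 * Re (f 0)"
    by (rule tendsto_upperbound) simp
  then show ?thesis by (simp add: c_def)
qed

section \<open>Embedding the complex plane as a slice\<close>

text \<open>For \<open>I\<close> in \<open>imag_units\<close> this is an isometric ring embedding
  that sends \<i> to \<open>I\<close>, so complex analysis can be transported to each slice.\<close>

definition slice_emb :: "quat \<Rightarrow> complex \<Rightarrow> quat" where
  "slice_emb I z = slice_pt I (Re z) (Im z)"

lemma bounded_linear_slice_emb: "bounded_linear (slice_emb I)"
  unfolding slice_emb_def slice_pt_def
  by (intro bounded_linear_add bounded_linear_compose [OF bounded_linear_mult_left]
      bounded_linear_compose [OF bounded_linear_of_real]
      bounded_linear_Re bounded_linear_Im)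

lemmas slice_emb_diff = linear_diff [OF bounded_linear.linear [OF bounded_linear_slice_emb]]
lemmas slice_emb_0 [simp] = linear_0 [OF bounded_linear.linear [OF bounded_linear_slice_emb]]

lemma slice_emb_1 [simp]: "slice_emb I 1 = 1"
  by (simp add: slice_emb_def slice_pt_def)

lemma slice_emb_of_real [simp]: "slice_emb I (of_real r) = of_real r"
  by (simp add: slice_emb_def slice_pt_def)

lemma slice_emb_of_nat [simp]: "slice_emb I (of_nat n) = of_nat n"
  by (metis of_real_of_nat_eq slice_emb_of_real)

lemma slice_emb_i [simp]: "slice_emb I \<i> = I"
  by (simp add: slice_emb_def slice_pt_def)

lemma slice_pt_eq_emb: "slice_pt I x y = slice_emb I (Complex x y)"
  by (simp add: slice_emb_def)

lemma imag_units_iff: "I \<in> imag_units \<longleftrightarrow> qRe I = 0 \<and> norm I = 1"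
proof
  assume I: "I \<in> imag_units"
  from imag_units_square [OF I] have "norm I * norm I = 1"
    by (metis norm_minus_cancel norm_mult norm_one)
  then have "norm I = 1" by (metis norm_ge_zero real_sqrt_abs2 real_sqrt_one abs_of_nonneg)
  with imag_units_qRe [OF I] show "qRe I = 0 \<and> norm I = 1" by simp
next
  assume "qRe I = 0 \<and> norm I = 1"
  then have "qRe I = 0" "(qI I)\<^sup>2 + (qJ I)\<^sup>2 + (qK I)\<^sup>2 = 1" by (auto simp: norm_quat_def)
  then show "I \<in> imag_units"
    by (simp add: imag_units_def quat_eq_iff power2_eq_square algebra_simps)
qed

lemma of_real_quat: "(of_real r :: quat) = Quat r 0 0 0"
  by (simp add: of_real_def quat_eq_iff)

lemma slice_emb_mult: "I \<in> imag_units \<Longrightarrow> slice_emb I (z * w) = slice_emb I z * slice_emb I w"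
proof -
  assume "I \<in> imag_units"
  then have "qRe I = 0" "(qI I)\<^sup>2 + (qJ I)\<^sup>2 + (qK I)\<^sup>2 = 1"
    by (auto simp: norm_quat_def imag_units_iff)
  then show ?thesis
    by (simp add: slice_emb_def slice_pt_def quat_eq_iff of_real_quat) algebra
qed

lemma slice_emb_power: "I \<in> imag_units \<Longrightarrow> slice_emb I (z ^ n) = slice_emb I z ^ n"
  by (induction n) (auto simp: slice_emb_mult)

lemma norm_slice_emb: "I \<in> imag_units \<Longrightarrow> norm (slice_emb I z) = norm z"
proof -
  assume "I \<in> imag_units"
  then have "qRe I = 0" "(qI I)\<^sup>2 + (qJ I)\<^sup>2 + (qK I)\<^sup>2 = 1"
    by (auto simp: norm_quat_def imag_units_iff)
  then have "(Re z)\<^sup>2 + (Im z * qI I)\<^sup>2 + (Im z * qJ I)\<^sup>2 + (Im z * qK I)\<^sup>2 = (Re z)\<^sup>2 + (Im z)\<^sup>2"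
    by algebra
  with \<open>qRe I = 0\<close> show ?thesis
    by (simp add: slice_emb_def slice_pt_def of_real_quat norm_quat_def cmod_def)
qed

lemma slice_emb_inverse:
  assumes I: "I \<in> imag_units" shows "slice_emb I (inverse z) = inverse (slice_emb I z)"
proof (cases "z = 0")
  case False
  then have "slice_emb I (inverse z) * slice_emb I z = 1"
    by (simp flip: slice_emb_mult [OF I])
  then show ?thesis by (metis inverse_unique inverse_inverse_eq)
qed simp

lemma slice_emb_in_ball: "I \<in> imag_units \<Longrightarrow> slice_emb I z \<in> quat_ball \<longleftrightarrow> z \<in> ball 0 1"
  by (simp add: quat_ball_def norm_slice_emb)

lemma slice_emb_exists: obtains I z where "I \<in> imag_units" "q = slice_emb I z"
  using imag_units_exists [of q] by (metis slice_pt_eq_emb)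

lemma has_vector_derivative_slice_emb:
  assumes "(f has_field_derivative d) (at (Complex x y))"
  shows "((\<lambda>s. slice_emb I (f (Complex s y))) has_vector_derivative slice_emb I d) (at x)"
    and "((\<lambda>t. slice_emb I (f (Complex x t))) has_vector_derivative slice_emb I (\<i> * d)) (at y)"
proof -
  have C: "Complex a b = of_real a + \<i> * of_real b" for a b by (simp add: complex_eq_iff)
  have "((\<lambda>s. Complex s y) has_vector_derivative 1) (at x)"
    unfolding C by (auto intro!: derivative_eq_intros)
  from field_vector_diff_chain_at [OF this assms]
  show "((\<lambda>s. slice_emb I (f (Complex s y))) has_vector_derivative slice_emb I d) (at x)"
    by (intro bounded_linear.has_vector_derivative [OF bounded_linear_slice_emb])
      (simp add: o_def)
  have "((\<lambda>t. Complex x t) has_vector_derivative \<i>) (at y)"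
    unfolding C by (auto intro!: derivative_eq_intros)
  from field_vector_diff_chain_at [OF this assms]
  show "((\<lambda>t. slice_emb I (f (Complex x t))) has_vector_derivative slice_emb I (\<i> * d)) (at y)"
    by (intro bounded_linear.has_vector_derivative [OF bounded_linear_slice_emb])
      (simp add: o_def mult.commute)
qed

section \<open>Quaternionic power series\<close>

text \<open>One real coordinate \<open>c\<close> of the coefficients, regarded as a complex series.
  The four coordinates together encode a quaternionic series by holomorphic functions that do not
  depend on the slice.\<close>

definition quat_fps :: "(quat \<Rightarrow> real) \<Rightarrow> (nat \<Rightarrow> quat) \<Rightarrow> complex fps" where
  "quat_fps c a = Abs_fps (\<lambda>n. of_real (c (a n)))"

lemma fps_nth_quat_fps [simp]: "fps_nth (quat_fps c a) n = of_real (c (a n))"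
  by (simp add: quat_fps_def)

definition quat_conv :: "(nat \<Rightarrow> quat) \<Rightarrow> bool" where
  "quat_conv a \<longleftrightarrow> (\<forall>c\<in>{qRe, qI, qJ, qK}. 1 \<le> fps_conv_radius (quat_fps c a))"

text \<open>Evaluation at \<open>I\<close> of the biquaternion with these complex coordinates. It is
  additive, but in general not multiplicative; \<open>biquat_emb_mult\<close> says what replaces
  multiplicativity.\<close>

definition biquat_emb :: "quat \<Rightarrow> complex \<Rightarrow> complex \<Rightarrow> complex \<Rightarrow> complex \<Rightarrow> quat" where
  "biquat_emb I c0 c1 c2 c3 = slice_emb I c0 + slice_emb I c1 * Quat 0 1 0 0 +
     slice_emb I c2 * Quat 0 0 1 0 + slice_emb I c3 * Quat 0 0 0 1"

definition biquat_series :: "quat \<Rightarrow> (nat \<Rightarrow> quat) \<Rightarrow> complex \<Rightarrow> quat" where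
  "biquat_series I a z = biquat_emb I (eval_fps (quat_fps qRe a) z) (eval_fps (quat_fps qI a) z)
     (eval_fps (quat_fps qJ a) z) (eval_fps (quat_fps qK a) z)"

lemma bounded_linear_quat_components:
  "bounded_linear qRe" "bounded_linear qI" "bounded_linear qJ" "bounded_linear qK"
proof -
  have "bounded_linear (\<lambda>x. inner x (Quat 1 0 0 0))" "bounded_linear (\<lambda>x. inner x (Quat 0 1 0 0))"
    "bounded_linear (\<lambda>x. inner x (Quat 0 0 1 0))" "bounded_linear (\<lambda>x. inner x (Quat 0 0 0 1))"
    by (rule bounded_linear_inner_left)+
  then show "bounded_linear qRe" "bounded_linear qI" "bounded_linear qJ" "bounded_linear qK"
    by (simp_all add: inner_quat_def)
qed

text \<open>Real radii suffice: bounded linear coordinates inherit convergence, and the radius of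
  convergence of a scalar series is detected on the positive axis.\<close>

lemma quat_convI:
  assumes "\<And>r. 0 < r \<Longrightarrow> r < 1 \<Longrightarrow> summable (\<lambda>k. r ^ k *\<^sub>R a k)"
  shows "quat_conv a"
proof -
  have "1 \<le> fps_conv_radius (quat_fps c a)" if c: "bounded_linear c" for c
    unfolding fps_conv_radius_def
  proof (rule conv_radius_geI_ex')
    fix r assume "0 < r" "ereal r < 1"
    then have "summable (\<lambda>k. r ^ k *\<^sub>R a k)" using assms by simp
    from bounded_linear.summable [OF c this] have "summable (\<lambda>k. r ^ k * c (a k))"
      by (simp add: linear_cmul [OF bounded_linear.linear [OF c]])
    then have "summable (\<lambda>k. complex_of_real (r ^ k * c (a k)))"
      by (rule bounded_linear.summable [OF bounded_linear_of_real])
    then show "summable (\<lambda>n. fps_nth (quat_fps c a) n * of_real r ^ n)"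
      by (simp add: mult.commute)
  qed
  then show ?thesis
    unfolding quat_conv_def using bounded_linear_quat_components by auto
qed

lemma quat_conv_of_ball:
  assumes "\<And>q. q \<in> quat_ball \<Longrightarrow> (\<lambda>k. q ^ k * a k) sums f q"
  shows "quat_conv a"
proof (rule quat_convI)
  fix r :: real assume "0 < r" "r < 1"
  then have "of_real r \<in> quat_ball" by (simp add: quat_ball_def)
  from sums_summable [OF assms [OF this]] show "summable (\<lambda>k. r ^ k *\<^sub>R a k)"
    by (simp add: scaleR_conv_of_real)
qed

text \<open>Real coordinates are central, so the complex factor \<open>w\<close> moves out to the
  left. Applied to each term, this turns the coordinate series into the series of
  \<open>q ^ k * a k\<close>.\<close>

lemma biquat_emb_of_real_mult:
  assumes "I \<in> imag_units"
  shows "biquat_emb I (of_real (qRe a) * w) (of_real (qI a) * w) (of_real (qJ a) * w)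
    (of_real (qK a) * w) = slice_emb I w * a"
proof -
  have "slice_emb I (of_real r * w) * v = slice_emb I w * (of_real r * v)" for r v
    by (simp add: slice_emb_mult [OF assms] mult.commute [of _ w] mult.assoc
        del: slice_emb_of_real) (simp)
  moreover have "of_real (qRe a) + of_real (qI a) * Quat 0 1 0 0 + of_real (qJ a) * Quat 0 0 1 0 +
     of_real (qK a) * Quat 0 0 0 1 = a"
    by (simp add: quat_eq_iff of_real_quat)
  moreover have "slice_emb I (of_real r * w) = slice_emb I w * of_real r" for r
    by (simp add: slice_emb_mult [OF assms] mult.commute [of _ w])
  ultimately show ?thesis
    unfolding biquat_emb_def by (metis distrib_left)
qed

lemma sums_biquat_series:
  assumes I: "I \<in> imag_units" and a: "quat_conv a" and z: "z \<in> ball 0 1"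
  shows "(\<lambda>k. slice_emb I z ^ k * a k) sums biquat_series I a z"
proof -
  have s: "(\<lambda>k. of_real (c (a k)) * z ^ k) sums eval_fps (quat_fps c a) z"
    if "c \<in> {qRe, qI, qJ, qK}" for c
  proof -
    have "ereal (norm z) < 1" using z by simp
    also have "1 \<le> fps_conv_radius (quat_fps c a)" using a that unfolding quat_conv_def by blast
    finally show ?thesis using sums_eval_fps by fastforce
  qed
  have "(\<lambda>k. biquat_emb I (of_real (qRe (a k)) * z ^ k) (of_real (qI (a k)) * z ^ k)
      (of_real (qJ (a k)) * z ^ k) (of_real (qK (a k)) * z ^ k)) sums biquat_series I a z"
    unfolding biquat_emb_def biquat_series_def
    by (intro sums_add sums_mult2 bounded_linear.sums [OF bounded_linear_slice_emb] s) auto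
  then show ?thesis
    by (simp add: biquat_emb_of_real_mult [OF I] slice_emb_power [OF I])
qed

lemma ball_series_eq_biquat_series:
  assumes "\<And>q. q \<in> quat_ball \<Longrightarrow> (\<lambda>k. q ^ k * a k) sums f q"
    and "I \<in> imag_units" "z \<in> ball 0 1"
  shows "f (slice_emb I z) = biquat_series I a z"
  using sums_unique2 [OF assms(1) sums_biquat_series] quat_conv_of_ball [of a f] assms
  by (simp add: slice_emb_in_ball)

text \<open>By the Cauchy-Riemann equation the slice derivative is the partial derivative in
  \<open>x\<close>, and in that direction the four scalar series can be differentiated
  termwise.\<close>

lemma slice_deriv_sums:
  assumes f: "slice_regular f"
    and a: "\<And>q. q \<in> quat_ball \<Longrightarrow> (\<lambda>k. q ^ k * a k) sums f q"
    and q: "q \<in> quat_ball"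
  shows "(\<lambda>k. q ^ k * (of_nat (Suc k) * a (Suc k))) sums slice_deriv f q"
proof -
  define a' where "a' k = of_nat (Suc k) * a (Suc k)" for k
  obtain I z where I: "I \<in> imag_units" and qz: "q = slice_emb I z" by (rule slice_emb_exists)
  have z: "z \<in> ball 0 1" using q by (simp add: qz slice_emb_in_ball [OF I])
  have conv: "quat_conv a" by (rule quat_conv_of_ball) (rule a)
  have of_nat_mult: "of_nat n * v = real n *\<^sub>R v" for n and v :: quat
    by (simp add: scaleR_conv_of_real)
  have deriv_fps: "quat_fps c a' = fps_deriv (quat_fps c a)" if "bounded_linear c" for c
    using linear_cmul [OF bounded_linear.linear [OF that]]
    by (simp add: fps_eq_iff a'_def of_nat_mult del: of_nat_Suc)
  note deriv_fps = bounded_linear_quat_components [THEN deriv_fps]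
  have "quat_conv a'"
    using conv unfolding quat_conv_def
    by (auto simp: deriv_fps intro: order_trans [OF _ fps_conv_radius_deriv])
  then have "(\<lambda>k. q ^ k * a' k) sums biquat_series I a' z"
    unfolding qz by (rule sums_biquat_series [OF I _ z])
  moreover have "slice_deriv f q = biquat_series I a' z"
  proof -
    have "((\<lambda>s. biquat_series I a (Complex s (Im z))) has_vector_derivative
        biquat_series I a' z) (at (Re z))"
    proof -
      have D: "(eval_fps (quat_fps c a) has_field_derivative eval_fps (fps_deriv (quat_fps c a)) z)
          (at (Complex (Re z) (Im z)))" if "c \<in> {qRe, qI, qJ, qK}" for c
      proof -
        have "ereal (norm z) < 1" using z by simp
        also have "1 \<le> fps_conv_radius (quat_fps c a)"
          using conv that unfolding quat_conv_def by blast
        finally show ?thesis using has_field_derivative_eval_fps [of z] by simp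
      qed
      show ?thesis
        unfolding biquat_series_def biquat_emb_def deriv_fps
        by (intro has_vector_derivative_add
            bounded_linear.has_vector_derivative [OF bounded_linear_mult_left]
            has_vector_derivative_slice_emb D) auto
    qed
    then have "((\<lambda>s. f (slice_pt I s (Im z))) has_vector_derivative biquat_series I a' z) (at (Re z))"
    proof (rule has_vector_derivative_transform_within_open)
      show "open ((\<lambda>s. Complex s (Im z)) -` ball 0 1)"
      proof (rule open_vimage)
        show "continuous_on UNIV (\<lambda>s. Complex s (Im z))"
          by (simp add: Complex_eq continuous_intros)
      qed simp
      show "biquat_series I a (Complex s (Im z)) = f (slice_pt I s (Im z))"
        if "s \<in> (\<lambda>s. Complex s (Im z)) -` ball 0 1" for s
        using that ball_series_eq_biquat_series [OF a I, of "Complex s (Im z)"]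
        by (simp add: slice_pt_eq_emb)
    qed (use z in simp)
    then have "slice_dx f I (Re z) (Im z) = biquat_series I a' z"
      unfolding slice_dx_def by (rule vector_derivative_at)
    moreover have "q = slice_pt I (Re z) (Im z)" by (simp add: qz slice_emb_def)
    ultimately show ?thesis
      using slice_deriv_eq [OF f I] slice_deriv_eq_dx [OF f I] q by metis
  qed
  ultimately show ?thesis by (simp add: a'_def)
qed

section \<open>Slice regular functions are power series\<close>

text \<open>As \<open>v\<close> varies this is complex linear for the left multiplication by \<open>\<complex>\<^sub>I\<close>, so it turns slice
  regularity into holomorphy.\<close>

definition slice_coord :: "quat \<Rightarrow> quat \<Rightarrow> quat \<Rightarrow> complex" where
  "slice_coord I w v = Complex (inner v w) (inner v (I * w))"

lemma bounded_linear_slice_coord: "bounded_linear (slice_coord I w)"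
proof -
  have "slice_coord I w = (\<lambda>v. of_real (inner v w) + \<i> * of_real (inner v (I * w)))"
    by (simp add: slice_coord_def Complex_eq fun_eq_iff)
  moreover have "bounded_linear (\<lambda>v. of_real (inner v w) + \<i> * of_real (inner v (I * w)))"
    by (intro bounded_linear_add bounded_linear_compose [OF bounded_linear_mult_right]
        bounded_linear_compose [OF bounded_linear_of_real] bounded_linear_inner_left)
  ultimately show ?thesis by simp
qed

lemmas slice_coord_add = linear_add [OF bounded_linear.linear [OF bounded_linear_slice_coord]]

lemma slice_coord_emb_mult:
  assumes "I \<in> imag_units"
  shows "slice_coord I w (slice_emb I z * v) = z * slice_coord I w v"
proof -
  have "qRe I = 0" "(qI I)\<^sup>2 + (qJ I)\<^sup>2 + (qK I)\<^sup>2 = 1"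
    using assms by (auto simp: norm_quat_def imag_units_iff)
  then show ?thesis
    by (simp add: slice_coord_def complex_eq_iff inner_quat_def slice_emb_def slice_pt_def
        of_real_quat) algebra
qed

text \<open>Continuous partial derivatives give a total derivative. The Cauchy-Riemann equation
  makes it a left multiplication by elements of the slice, which \<open>slice_coord\<close> turns
  into complex multiplication.\<close>

lemma slice_coord_holomorphic:
  assumes f: "slice_regular f" and I: "I \<in> imag_units"
  shows "(\<lambda>z. slice_coord I w (f (slice_emb I z))) holomorphic_on ball 0 1"
proof (rule holomorphic_onI)
  fix z0 :: complex assume z0: "z0 \<in> ball 0 1"
  define U where "U = {(x, y). slice_pt I x y \<in> quat_ball}"
  have U: "(x, y) \<in> U \<longleftrightarrow> Complex x y \<in> ball 0 1" for x y
    by (simp add: U_def slice_pt_eq_emb slice_emb_in_ball [OF I])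
  have "open ((\<lambda>p. Complex (fst p) (snd p)) -` ball 0 1)"
    by (rule open_vimage) (auto simp: Complex_eq intro!: continuous_intros)
  moreover have "(\<lambda>p. Complex (fst p) (snd p)) -` ball 0 1 = U"
    using U by force
  ultimately have "open U" by simp
  define x0 y0 where "x0 = Re z0" and "y0 = Im z0"
  have "(x0, y0) \<in> U" using z0 by (simp add: U x0_def y0_def)
  from open_prod_elim [OF \<open>open U\<close> this]
  obtain S T where ST: "open S" "open T" "(x0, y0) \<in> S \<times> T" "S \<times> T \<subseteq> U" by blast
  then obtain e where e: "0 < e" "ball y0 e \<subseteq> T" by (metis mem_Times_iff open_contains_ball snd_conv)
  \<comment> \<open>A ball, because \<open>has_derivative_partialsI\<close> needs a convex set in
    the second variable.\<close>
  define Y where "Y = ball y0 e"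
  have Y: "open Y" "convex Y" "y0 \<in> Y" "S \<times> Y \<subseteq> U" using e ST by (auto simp: Y_def)
  have dx: "((\<lambda>s. f (slice_pt I s y)) has_vector_derivative slice_dx f I x y) (at x)"
    and dy: "((\<lambda>t. f (slice_pt I x t)) has_vector_derivative slice_dy f I x y) (at y)"
    and CR: "slice_dx f I x y + I * slice_dy f I x y = 0" if "(x, y) \<in> U" for x y
    using f I that unfolding slice_regular_def U_def slice_dx_def slice_dy_def
    by (auto simp: vector_derivative_works)
  have contU: "continuous_on U (\<lambda>(x, y). slice_dy f I x y)"
    using f I unfolding slice_regular_def U_def by blast
  define dx0 where "dx0 = slice_dx f I x0 y0"
  have dy0: "slice_dy f I x0 y0 = I * dx0"
  proof -
    have "I * (dx0 + I * slice_dy f I x0 y0) = 0"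
      using CR [OF \<open>(x0, y0) \<in> U\<close>] by (simp add: dx0_def)
    then show ?thesis
      by (simp add: distrib_left imag_units_square [OF I] flip: mult.assoc)
  qed
  have "((\<lambda>(x, y). f (slice_pt I x y)) has_derivative
      (\<lambda>(tx, ty). tx *\<^sub>R dx0 + blinfun_scaleR_left (slice_dy f I x0 y0) ty))
      (at (x0, y0) within S \<times> Y)"
  proof (rule has_derivative_partialsI)
    show "((\<lambda>x. f (slice_pt I x y0)) has_derivative (\<lambda>tx. tx *\<^sub>R dx0)) (at x0 within S)"
      using dx [OF \<open>(x0, y0) \<in> U\<close>] unfolding dx0_def has_vector_derivative_def
      by (rule has_derivative_at_withinI)
    show "((\<lambda>y. f (slice_pt I x y)) has_derivative blinfun_scaleR_left (slice_dy f I x y))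
        (at y within Y)" if "x \<in> S" "y \<in> Y" for x y
      using dy [of x y] that Y unfolding has_vector_derivative_def
      by (auto intro: has_derivative_at_withinI)
    have "continuous_on (S \<times> Y) (\<lambda>p. blinfun_scaleR_left (case p of (x, y) \<Rightarrow> slice_dy f I x y))"
      by (intro bounded_linear.continuous_on [OF bounded_linear_blinfun_scaleR_left]
          continuous_on_subset [OF contU] Y)
    then show "continuous (at (x0, y0) within S \<times> Y)
        (\<lambda>(x, y). blinfun_scaleR_left (slice_dy f I x y))"
      using ST Y by (simp add: continuous_on_eq_continuous_within split_def)
  qed (use Y in auto)
  moreover have "at (x0, y0) within S \<times> Y = at (x0, y0)"
    using ST Y by (intro at_within_open open_Times) auto
  ultimately have "((\<lambda>p. f (slice_pt I (fst p) (snd p))) has_derivative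
      (\<lambda>t. fst t *\<^sub>R dx0 + snd t *\<^sub>R (I * dx0))) (at (Re z0, Im z0))"
    by (simp add: dy0 split_def flip: x0_def y0_def)
  moreover have "((\<lambda>z. (Re z, Im z)) has_derivative (\<lambda>h. (Re h, Im h))) (at z0)"
    by (intro has_derivative_Pair bounded_linear_imp_has_derivative bounded_linear_Re bounded_linear_Im)
  ultimately have "((\<lambda>z. f (slice_emb I z)) has_derivative
      (\<lambda>h. Re h *\<^sub>R dx0 + Im h *\<^sub>R (I * dx0))) (at z0)"
    using has_derivative_compose [of "\<lambda>z. (Re z, Im z)"] unfolding slice_emb_def by fastforce
  then have "((\<lambda>z. slice_coord I w (f (slice_emb I z))) has_derivative
      (\<lambda>h. slice_coord I w (Re h *\<^sub>R dx0 + Im h *\<^sub>R (I * dx0)))) (at z0)"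
    by (rule bounded_linear.has_derivative [OF bounded_linear_slice_coord])
  \<comment> \<open>The real differential is left multiplication of \<open>dx0\<close> by
    \<open>slice_emb I h\<close>, hence complex linear in \<open>h\<close>.\<close>
  moreover have "slice_coord I w (Re h *\<^sub>R dx0 + Im h *\<^sub>R (I * dx0)) = slice_coord I w dx0 * h" for h
  proof -
    have "Re h *\<^sub>R dx0 + Im h *\<^sub>R (I * dx0) = slice_emb I h * dx0"
      by (simp add: slice_emb_def slice_pt_def distrib_right scaleR_conv_of_real mult.assoc)
    then show ?thesis by (simp add: slice_coord_emb_mult [OF I] mult.commute)
  qed
  ultimately have "((\<lambda>z. slice_coord I w (f (slice_emb I z))) has_field_derivative
      slice_coord I w dx0) (at z0)"
    by (simp add: has_field_derivative_def)
  then show "(\<lambda>z. slice_coord I w (f (slice_emb I z))) field_differentiable at z0 within ball 0 1"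
    using field_differentiable_at_within field_differentiable_def by blast
qed

text \<open>The coefficients come from Taylor expansions in a single slice. The series agrees with
  \<open>f\<close> on the real diameter, which lies in every slice, so the identity theorem extends
  the agreement to all slices.\<close>

lemma slice_regular_power_series:
  assumes f: "slice_regular f"
  obtains a where "\<And>q. q \<in> quat_ball \<Longrightarrow> (\<lambda>k. q ^ k * a k) sums f q"
proof -
  define i where "i = Quat 0 1 0 0"
  define F where "F w z = slice_coord i w (f (slice_emb i z))" for w z
  define cf where "cf w k = (deriv ^^ k) (F w) 0 / fact k" for w k
  \<comment> \<open>Since \<open>i * j = k\<close>, the coordinate maps for \<open>w = 1\<close> and
    \<open>w = j\<close> together read off all four real coordinates.\<close>
  define a where "a k = Quat (Re (cf 1 k)) (Im (cf 1 k))
     (Re (cf (Quat 0 0 1 0) k)) (Im (cf (Quat 0 0 1 0) k))" for k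
  have i: "i \<in> imag_units"
    by (simp add: i_def imag_units_iff norm_quat_def)
  have real_series: "(\<lambda>k. r ^ k *\<^sub>R a k) sums f (of_real r)" if r: "\<bar>r\<bar> < 1" for r :: real
  proof -
    have "(\<lambda>k. cf w k * (of_real r - 0) ^ k) sums F w (of_real r)" for w
      unfolding cf_def using r
      by (intro holomorphic_power_series) (auto simp: F_def [abs_def] intro: slice_coord_holomorphic [OF f i])
    then have *: "(\<lambda>k. Re (cf w k) * r ^ k) sums Re (F w (of_real r))"
        "(\<lambda>k. Im (cf w k) * r ^ k) sums Im (F w (of_real r))" for w
      unfolding sums_complex_iff by (simp_all flip: of_real_power)
    have "(\<lambda>k. (Re (cf 1 k) * r ^ k) *\<^sub>R Quat 1 0 0 0 + (Im (cf 1 k) * r ^ k) *\<^sub>R Quat 0 1 0 0 +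
        (Re (cf (Quat 0 0 1 0) k) * r ^ k) *\<^sub>R Quat 0 0 1 0 +
        (Im (cf (Quat 0 0 1 0) k) * r ^ k) *\<^sub>R Quat 0 0 0 1)
      sums (Re (F 1 (of_real r)) *\<^sub>R Quat 1 0 0 0 + Im (F 1 (of_real r)) *\<^sub>R Quat 0 1 0 0 +
        Re (F (Quat 0 0 1 0) (of_real r)) *\<^sub>R Quat 0 0 1 0 +
        Im (F (Quat 0 0 1 0) (of_real r)) *\<^sub>R Quat 0 0 0 1)"
      by (intro sums_add bounded_linear.sums [OF bounded_linear_scaleR_left] *)
    then show ?thesis
      by (rule back_subst [of "\<lambda>s. s"], intro arg_cong2 [where f = "(sums)"] ext)
        (simp_all add: a_def F_def slice_coord_def quat_eq_iff inner_quat_def i_def mult.commute)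
  qed
  have conv: "quat_conv a"
    by (rule quat_convI) (use real_series sums_summable in force)
  have "(\<lambda>k. q ^ k * a k) sums f q" if "q \<in> quat_ball" for q
  proof -
    obtain I z where I: "I \<in> imag_units" and qz: "q = slice_emb I z" by (rule slice_emb_exists)
    have z: "z \<in> ball 0 1" using that by (simp add: qz slice_emb_in_ball [OF I])
    have "slice_coord I w (f (slice_emb I z)) = slice_coord I w (biquat_series I a z)" for w
    proof -
      define D where "D z = slice_coord I w (f (slice_emb I z)) -
        slice_coord I w (biquat_series I a z)" for z
      have "D z = 0"
      \<comment> \<open>Identity theorem: \<open>D\<close> is holomorphic and vanishes on the real
        diameter, which accumulates at 0.\<close>
      proof (rule analytic_continuation [of D "ball 0 1" "of_real ` {-1<..<1}" 0])
        have hol: "eval_fps (quat_fps c a) holomorphic_on ball 0 1" if "c \<in> {qRe, qI, qJ, qK}" for c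
        proof -
          have "1 \<le> fps_conv_radius (quat_fps c a)"
            using conv that unfolding quat_conv_def by blast
          then show ?thesis
            by (intro holomorphic_on_eval_fps ball_eball_mono) (simp add: one_ereal_def)
        qed
        have emb: "slice_coord I w (slice_emb I z) = z * slice_coord I w 1" for z
          using slice_coord_emb_mult [OF I, of w z 1] by simp
        have "slice_coord I w (biquat_series I a z) =
          eval_fps (quat_fps qRe a) z * slice_coord I w 1 +
          eval_fps (quat_fps qI a) z * slice_coord I w (Quat 0 1 0 0) +
          eval_fps (quat_fps qJ a) z * slice_coord I w (Quat 0 0 1 0) +
          eval_fps (quat_fps qK a) z * slice_coord I w (Quat 0 0 0 1)" for z
          by (simp add: biquat_series_def biquat_emb_def slice_coord_add
              slice_coord_emb_mult [OF I] emb)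
        then show "D holomorphic_on ball 0 1"
          unfolding D_def
          by (auto intro!: holomorphic_on_add holomorphic_on_diff holomorphic_on_mult
              holomorphic_on_const slice_coord_holomorphic f I hol)
        have "((\<lambda>n. of_real (1 / real (n + 2))) \<longlonglongrightarrow> complex_of_real 0)"
          by (intro tendsto_of_real) real_asymp
        moreover have "of_real (1 / real (n + 2)) \<in> complex_of_real ` {-1<..<1} - {0}" for n
        proof -
          have "1 / real (n + 2) \<in> {-1<..<1}" "1 / real (n + 2) \<noteq> 0"
            by (auto simp: field_simps)
          then show ?thesis by (metis DiffI empty_iff imageI insert_iff of_real_eq_0_iff)
        qed
        ultimately show "(0::complex) islimpt of_real ` {-1<..<1}"
          unfolding islimpt_sequential of_real_0
          by (intro exI [of _ "\<lambda>n. of_real (1 / real (n + 2))"]) blast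
        show "D t = 0" if t: "t \<in> of_real ` {-1<..<1}" for t
        proof -
          from t obtain r where r: "t = of_real r" "\<bar>r\<bar> < 1" by auto
          have "(\<lambda>k. slice_emb I t ^ k * a k) sums biquat_series I a t"
            by (rule sums_biquat_series [OF I conv]) (use r in simp)
          moreover have "(\<lambda>k. slice_emb I t ^ k * a k) sums f (slice_emb I t)"
            using real_series [OF r(2)] r by (simp add: scaleR_conv_of_real)
          ultimately have "biquat_series I a t = f (slice_emb I t)" by (rule sums_unique2)
          then show ?thesis by (simp add: D_def)
        qed
      qed (use z in auto)
      then show ?thesis by (simp add: D_def)
    qed
    \<comment> \<open>The real part of \<open>slice_coord I w\<close> is the inner product with
      \<open>w\<close>, so varying \<open>w\<close> determines the quaternion.\<close>
    then have "inner (f (slice_emb I z)) w = inner (biquat_series I a z) w" for w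
      unfolding slice_coord_def by blast
    then have "f q = biquat_series I a z"
      unfolding qz by (rule euclidean_eqI)
    then show ?thesis using sums_biquat_series [OF I conv z] by (simp add: qz)
  qed
  with that show ?thesis by blast
qed

section \<open>The regular quotient\<close>

definition biquat_re :: "complex \<Rightarrow> complex \<Rightarrow> complex \<Rightarrow> complex \<Rightarrow> quat" where
  "biquat_re c0 c1 c2 c3 = Quat (Re c0) (Re c1) (Re c2) (Re c3)"

definition biquat_im :: "complex \<Rightarrow> complex \<Rightarrow> complex \<Rightarrow> complex \<Rightarrow> quat" where
  "biquat_im c0 c1 c2 c3 = Quat (Im c0) (Im c1) (Im c2) (Im c3)"

lemma biquat_emb_split:
  "biquat_emb I c0 c1 c2 c3 = biquat_re c0 c1 c2 c3 + I * biquat_im c0 c1 c2 c3"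
  by (simp add: biquat_emb_def biquat_re_def biquat_im_def slice_emb_def slice_pt_def of_real_quat
      quat_eq_iff algebra_simps)

text \<open>The coordinates on the left are those of the biquaternion product. With
  \<open>Y = Y1 + \<i> Y2\<close>, the central unit in front of \<open>Y2\<close> is evaluated as an
  \<open>I\<close> on the far left, before the first factor, and need not commute past it.\<close>

lemma biquat_emb_mult:
  assumes "I \<in> imag_units"
  shows "biquat_emb I (x0 * y0 - x1 * y1 - x2 * y2 - x3 * y3)
      (x0 * y1 + x1 * y0 + x2 * y3 - x3 * y2)
      (x0 * y2 - x1 * y3 + x2 * y0 + x3 * y1)
      (x0 * y3 + x1 * y2 - x2 * y1 + x3 * y0) =
    biquat_emb I x0 x1 x2 x3 * biquat_re y0 y1 y2 y3 +
    I * biquat_emb I x0 x1 x2 x3 * biquat_im y0 y1 y2 y3" (is "biquat_emb I ?p0 ?p1 ?p2 ?p3 = _")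
proof -
  let ?X1 = "biquat_re x0 x1 x2 x3" and ?X2 = "biquat_im x0 x1 x2 x3"
  let ?Y1 = "biquat_re y0 y1 y2 y3" and ?Y2 = "biquat_im y0 y1 y2 y3"
  have "biquat_re ?p0 ?p1 ?p2 ?p3 = ?X1 * ?Y1 - ?X2 * ?Y2"
    "biquat_im ?p0 ?p1 ?p2 ?p3 = ?X1 * ?Y2 + ?X2 * ?Y1"
    by (simp_all add: biquat_re_def biquat_im_def quat_eq_iff algebra_simps)
  then have "biquat_emb I ?p0 ?p1 ?p2 ?p3 = ?X1 * ?Y1 - ?X2 * ?Y2 + I * (?X1 * ?Y2 + ?X2 * ?Y1)"
    by (simp add: biquat_emb_split)
  also have "\<dots> = (?X1 + I * ?X2) * ?Y1 + I * (?X1 + I * ?X2) * ?Y2"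
    by (simp add: distrib_left distrib_right left_diff_distrib imag_units_square [OF assms]
        flip: mult.assoc)
  finally show ?thesis by (simp add: biquat_emb_split)
qed

lemma imag_units_conjugate:
  assumes "I \<in> imag_units" "c \<noteq> 0" shows "inverse c * I * c \<in> imag_units"
proof -
  have "(inverse c * I * c)\<^sup>2 = inverse c * (I * (c * inverse c) * I) * c"
    by (simp add: power2_eq_square mult.assoc del: right_inverse)
  also have "\<dots> = - 1" using assms by (simp add: imag_units_square)
  finally show ?thesis by (simp add: imag_units_def)
qed

text \<open>A zero divisor \<open>A\<^sub>1 + \<i> A\<^sub>2\<close> has orthogonal parts of equal norm, so it is annihilated by evaluation
  at the imaginary unit \<open>- A\<^sub>1 A\<^sub>2\<^sup>-\<^sup>1\<close>.\<close>

lemma biquat_norm_nonzero: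
  assumes nz: "\<And>I. I \<in> imag_units \<Longrightarrow> biquat_emb I a0 a1 a2 a3 \<noteq> 0"
  shows "a0\<^sup>2 + a1\<^sup>2 + a2\<^sup>2 + a3\<^sup>2 \<noteq> 0"
proof
  assume N: "a0\<^sup>2 + a1\<^sup>2 + a2\<^sup>2 + a3\<^sup>2 = 0"
  define A1 A2 where "A1 = biquat_re a0 a1 a2 a3" and "A2 = biquat_im a0 a1 a2 a3"
  have "inner A1 A1 - inner A2 A2 = Re (a0\<^sup>2 + a1\<^sup>2 + a2\<^sup>2 + a3\<^sup>2)"
    by (simp add: A1_def A2_def biquat_re_def biquat_im_def inner_quat_def power2_eq_square)
  then have eq: "norm A1 = norm A2" using N by (simp add: norm_eq_sqrt_inner)
  have "2 * inner A1 A2 = Im (a0\<^sup>2 + a1\<^sup>2 + a2\<^sup>2 + a3\<^sup>2)"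
    by (simp add: A1_def A2_def biquat_re_def biquat_im_def inner_quat_def power2_eq_square)
  then have orth: "inner A1 A2 = 0" using N by simp
  have ne: "A1 + I * A2 \<noteq> 0" if "I \<in> imag_units" for I
    using nz [OF that] by (simp add: biquat_emb_split A1_def A2_def)
  show False
  proof (cases "A2 = 0")
    case True
    with eq have "A1 = 0" by simp
    with True ne imag_units_exists show False by auto
  next
    case False
    define I where "I = - (A1 * inverse A2)"
    have "qRe I = - inner A1 A2 / (norm A2)\<^sup>2"
      by (simp add: I_def inverse_quat_def inner_quat_def divide_inverse algebra_simps)
    then have "I \<in> imag_units"
      using False eq orth by (simp add: imag_units_iff I_def norm_mult norm_inverse)
    moreover have "A1 + I * A2 = 0" using False by (simp add: I_def mult.assoc)
    ultimately show False using ne by blast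
  qed
qed

text \<open>The fractions are the coordinates of \<open>conj a * b / N\<close>, that is, of the
  regular quotient of \<open>b\<close> by \<open>a\<close>. Its value at \<open>I\<close> is the
  pointwise quotient at the conjugated unit \<open>J\<close>, where \<open>pos\<close>
  applies.\<close>

lemma biquat_quotient:
  assumes pos: "\<And>I. I \<in> imag_units \<Longrightarrow>
      qRe (inverse (biquat_emb I a0 a1 a2 a3) * biquat_emb I b0 b1 b2 b3) > 0"
    and nz: "N \<noteq> 0" and N: "N = a0\<^sup>2 + a1\<^sup>2 + a2\<^sup>2 + a3\<^sup>2"
    and I: "I \<in> imag_units"
  shows "qRe (biquat_emb I ((a0 * b0 + a1 * b1 + a2 * b2 + a3 * b3) / N)
     ((a0 * b1 - a1 * b0 - a2 * b3 + a3 * b2) / N)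
     ((a0 * b2 + a1 * b3 - a2 * b0 - a3 * b1) / N)
     ((a0 * b3 - a1 * b2 + a2 * b1 - a3 * b0) / N)) > 0" (is "qRe ?P > 0")
proof -
  define c where "c = biquat_emb I (a0 / N) (- a1 / N) (- a2 / N) (- a3 / N)"
  define J where "J = inverse c * I * c"
  have prod: "biquat_emb I ((a0 * y0 + a1 * y1 + a2 * y2 + a3 * y3) / N)
     ((a0 * y1 - a1 * y0 - a2 * y3 + a3 * y2) / N)
     ((a0 * y2 + a1 * y3 - a2 * y0 - a3 * y1) / N)
     ((a0 * y3 - a1 * y2 + a2 * y1 - a3 * y0) / N) =
     c * biquat_re y0 y1 y2 y3 + I * c * biquat_im y0 y1 y2 y3" for y0 y1 y2 y3
    using biquat_emb_mult [OF I, of "a0 / N" y0 "- a1 / N" y1 "- a2 / N" y2 "- a3 / N" y3]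
    by (simp add: c_def add_divide_distrib diff_divide_distrib)
  \<comment> \<open>The case \<open>b = a\<close>. Together with \<open>emb_J\<close> it identifies
    \<open>c\<close> as the inverse of the evaluation of \<open>a\<close> at
    \<open>J\<close>.\<close>
  have one: "c * biquat_re a0 a1 a2 a3 + I * c * biquat_im a0 a1 a2 a3 = 1"
    unfolding prod [symmetric] using nz
    by (simp add: biquat_emb_def mult.commute flip: power2_eq_square N)
  then have c: "c \<noteq> 0" by auto
  then have J: "J \<in> imag_units" unfolding J_def by (rule imag_units_conjugate [OF I])
  \<comment> \<open>By definition of \<open>J\<close>, \<open>I * c = c * J\<close>.\<close>
  have emb_J: "c * biquat_re y0 y1 y2 y3 + I * c * biquat_im y0 y1 y2 y3 =
      c * biquat_emb J y0 y1 y2 y3" for y0 y1 y2 y3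
    using c by (simp add: J_def biquat_emb_split distrib_left flip: mult.assoc)
  have c_eq: "c = inverse (biquat_emb J a0 a1 a2 a3)"
    using one [unfolded emb_J] by (metis inverse_unique inverse_inverse_eq)
  have "?P = c * biquat_emb J b0 b1 b2 b3"
    by (simp only: prod emb_J)
  with c_eq show ?thesis using pos [OF J] by simp
qed

text \<open>Isolates the only term of the convolution that contains the newest coefficient of
  \<open>F\<close>; this drives the induction showing that the quotient has real coordinate
  coefficients.\<close>

lemma fps_mult_nth_Reals:
  fixes F G :: "complex fps"
  assumes "\<And>i. fps_nth G i \<in> \<real>" "\<And>m. m < n \<Longrightarrow> fps_nth F m \<in> \<real>"
  shows "fps_nth (G * F) n - fps_nth G 0 * fps_nth F n \<in> \<real>"
proof -
  have "fps_nth (G * F) n - fps_nth G 0 * fps_nth F n =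
      (\<Sum>i=Suc 0..n. fps_nth G i * fps_nth F (n - i))"
    by (simp add: fps_mult_nth sum.atLeast_Suc_atMost)
  also have "\<dots> \<in> \<real>"
    using assms by (intro sum_in_Reals Reals_mult) auto
  finally show ?thesis .
qed

text \<open>\<open>P\<close> is the coefficient sequence of the regular quotient. Its coordinates
  \<open>p0\<close> to \<open>p3\<close> are holomorphic with real Taylor coefficients, and the
  identity \<beta> = \<alpha> * p gives the convolution formula. The norm bound is Caratheodory's
  lemma applied to one scalar function for each \<open>n\<close>.\<close>

lemma slice_quotient_coeffs:
  assumes a: "\<And>q. q \<in> quat_ball \<Longrightarrow> (\<lambda>k. q ^ k * a k) sums A q" and a0: "a 0 = 1"
    and b: "\<And>q. q \<in> quat_ball \<Longrightarrow> (\<lambda>k. q ^ k * b k) sums B q" and b0: "b 0 = 1"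
    and nz: "\<And>q. q \<in> quat_ball \<Longrightarrow> A q \<noteq> 0"
    and pos: "\<And>q. q \<in> quat_ball \<Longrightarrow> qRe (inverse (A q) * B q) > 0"
  obtains P where "P 0 = 1" "\<And>n. 0 < n \<Longrightarrow> norm (P n) \<le> 2"
    "\<And>n. b n = (\<Sum>j=0..n. a j * P (n - j))"
proof -
  have conv: "quat_conv a" "quat_conv b"
    by (rule quat_conv_of_ball, erule a, rule quat_conv_of_ball, erule b)
  define \<alpha> where "\<alpha> c = eval_fps (quat_fps c a)" for c
  define \<beta> where "\<beta> c = eval_fps (quat_fps c b)" for c
  have radius: "1 \<le> fps_conv_radius (quat_fps c a)" "1 \<le> fps_conv_radius (quat_fps c b)"
    if "c \<in> {qRe, qI, qJ, qK}" for c
    using conv that unfolding quat_conv_def by blast+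
  have hol: "\<alpha> c holomorphic_on ball 0 1" "\<beta> c holomorphic_on ball 0 1"
    if "c \<in> {qRe, qI, qJ, qK}" for c
    unfolding \<alpha>_def \<beta>_def using radius [OF that]
    by (auto intro!: holomorphic_on_eval_fps ball_eball_mono simp: one_ereal_def)
  have exp: "\<alpha> c has_fps_expansion quat_fps c a" "\<beta> c has_fps_expansion quat_fps c b"
    if "c \<in> {qRe, qI, qJ, qK}" for c
    unfolding \<alpha>_def \<beta>_def using radius [OF that] less_le_trans [of 0 "1::ereal"]
    by (auto intro!: eval_fps_has_fps_expansion)
  have emb: "biquat_emb I (\<alpha> qRe z) (\<alpha> qI z) (\<alpha> qJ z) (\<alpha> qK z) = A (slice_emb I z)"
    "biquat_emb I (\<beta> qRe z) (\<beta> qI z) (\<beta> qJ z) (\<beta> qK z) = B (slice_emb I z)"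
    if "I \<in> imag_units" "z \<in> ball 0 1" for I z
    using ball_series_eq_biquat_series [OF a that] ball_series_eq_biquat_series [OF b that]
    by (simp_all add: biquat_series_def \<alpha>_def \<beta>_def)
  define N where "N z = (\<alpha> qRe z)\<^sup>2 + (\<alpha> qI z)\<^sup>2 + (\<alpha> qJ z)\<^sup>2 + (\<alpha> qK z)\<^sup>2" for z
  have N: "N z \<noteq> 0" if "z \<in> ball 0 1" for z
    unfolding N_def
    by (rule biquat_norm_nonzero) (use nz that in \<open>simp add: emb slice_emb_in_ball del: mem_ball\<close>)
  define p0 where "p0 z = (\<alpha> qRe z * \<beta> qRe z + \<alpha> qI z * \<beta> qI z + \<alpha> qJ z * \<beta> qJ z +
    \<alpha> qK z * \<beta> qK z) / N z" for z
  define p1 where "p1 z = (\<alpha> qRe z * \<beta> qI z - \<alpha> qI z * \<beta> qRe z - \<alpha> qJ z * \<beta> qK z +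
    \<alpha> qK z * \<beta> qJ z) / N z" for z
  define p2 where "p2 z = (\<alpha> qRe z * \<beta> qJ z + \<alpha> qI z * \<beta> qK z - \<alpha> qJ z * \<beta> qRe z -
    \<alpha> qK z * \<beta> qI z) / N z" for z
  define p3 where "p3 z = (\<alpha> qRe z * \<beta> qK z - \<alpha> qI z * \<beta> qJ z + \<alpha> qJ z * \<beta> qI z -
    \<alpha> qK z * \<beta> qRe z) / N z" for z
  have p_hol: "p0 holomorphic_on ball 0 1" "p1 holomorphic_on ball 0 1"
    "p2 holomorphic_on ball 0 1" "p3 holomorphic_on ball 0 1"
    unfolding p0_def [abs_def] p1_def [abs_def] p2_def [abs_def] p3_def [abs_def]
    by (intro holomorphic_intros hol N; simp add: N_def; intro holomorphic_intros hol; simp)+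
  have p_pos: "qRe (biquat_emb I (p0 z) (p1 z) (p2 z) (p3 z)) > 0"
    if "I \<in> imag_units" "z \<in> ball 0 1" for I z
    unfolding p0_def p1_def p2_def p3_def
    by (rule biquat_quotient [OF _ N N_def])
      (use pos that in \<open>simp_all add: emb slice_emb_in_ball del: mem_ball\<close>)
  define F0 F1 F2 F3 where "F0 = fps_expansion p0 0" and "F1 = fps_expansion p1 0"
    and "F2 = fps_expansion p2 0" and "F3 = fps_expansion p3 0"
  have p_exp: "p0 has_fps_expansion F0" "p1 has_fps_expansion F1"
    "p2 has_fps_expansion F2" "p3 has_fps_expansion F3"
    unfolding F0_def F1_def F2_def F3_def
    by (rule has_fps_expansion_fps_expansion [of "ball 0 1"]; use p_hol in simp)+
  have fps_eqI: "F = G" if "f has_fps_expansion F" "g has_fps_expansion G"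
    "\<And>z. z \<in> ball 0 1 \<Longrightarrow> f z = g z" for f g :: "complex \<Rightarrow> complex" and F G
  proof -
    have "eventually (\<lambda>z. f z = g z) (nhds 0)"
      by (rule eventually_nhds_in_open [of "ball 0 1", THEN eventually_mono]) (use that in auto)
    with that(1) have "g has_fps_expansion F"
      using has_fps_expansion_cong by blast
    with that(2) show ?thesis by (metis fps_expansion_unique_complex)
  qed
  let ?a = "\<lambda>c. quat_fps c a"
  \<comment> \<open>The equations \<open>e0\<close> to \<open>e3\<close> are the four coordinates of
    \<beta> = \<alpha> * p, first as functions on the disc and then as formal series.\<close>
  have e0: "quat_fps qRe b = ?a qRe * F0 - ?a qI * F1 - ?a qJ * F2 - ?a qK * F3"
  proof (rule fps_eqI)
    show "(\<lambda>z. \<alpha> qRe z * p0 z - \<alpha> qI z * p1 z - \<alpha> qJ z * p2 z - \<alpha> qK z * p3 z) has_fps_expansion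
        ?a qRe * F0 - ?a qI * F1 - ?a qJ * F2 - ?a qK * F3"
      by (intro fps_expansion_intros exp p_exp) auto
    fix z :: complex assume "z \<in> ball 0 1"
    from N [OF this] show "\<beta> qRe z = \<alpha> qRe z * p0 z - \<alpha> qI z * p1 z - \<alpha> qJ z * p2 z - \<alpha> qK z * p3 z"
      by (simp add: p0_def p1_def p2_def p3_def divide_simps) (simp add: N_def, algebra)
  qed (intro exp, simp)
  have e1: "quat_fps qI b = ?a qRe * F1 + ?a qI * F0 + ?a qJ * F3 - ?a qK * F2"
  proof (rule fps_eqI)
    show "(\<lambda>z. \<alpha> qRe z * p1 z + \<alpha> qI z * p0 z + \<alpha> qJ z * p3 z - \<alpha> qK z * p2 z) has_fps_expansion
        ?a qRe * F1 + ?a qI * F0 + ?a qJ * F3 - ?a qK * F2"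
      by (intro fps_expansion_intros exp p_exp) auto
    fix z :: complex assume "z \<in> ball 0 1"
    from N [OF this] show "\<beta> qI z = \<alpha> qRe z * p1 z + \<alpha> qI z * p0 z + \<alpha> qJ z * p3 z - \<alpha> qK z * p2 z"
      by (simp add: p0_def p1_def p2_def p3_def divide_simps) (simp add: N_def, algebra)
  qed (intro exp, simp)
  have e2: "quat_fps qJ b = ?a qRe * F2 - ?a qI * F3 + ?a qJ * F0 + ?a qK * F1"
  proof (rule fps_eqI)
    show "(\<lambda>z. \<alpha> qRe z * p2 z - \<alpha> qI z * p3 z + \<alpha> qJ z * p0 z + \<alpha> qK z * p1 z) has_fps_expansion
        ?a qRe * F2 - ?a qI * F3 + ?a qJ * F0 + ?a qK * F1"
      by (intro fps_expansion_intros exp p_exp) auto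
    fix z :: complex assume "z \<in> ball 0 1"
    from N [OF this] show "\<beta> qJ z = \<alpha> qRe z * p2 z - \<alpha> qI z * p3 z + \<alpha> qJ z * p0 z + \<alpha> qK z * p1 z"
      by (simp add: p0_def p1_def p2_def p3_def divide_simps) (simp add: N_def, algebra)
  qed (intro exp, simp)
  have e3: "quat_fps qK b = ?a qRe * F3 + ?a qI * F2 - ?a qJ * F1 + ?a qK * F0"
  proof (rule fps_eqI)
    show "(\<lambda>z. \<alpha> qRe z * p3 z + \<alpha> qI z * p2 z - \<alpha> qJ z * p1 z + \<alpha> qK z * p0 z) has_fps_expansion
        ?a qRe * F3 + ?a qI * F2 - ?a qJ * F1 + ?a qK * F0"
      by (intro fps_expansion_intros exp p_exp) auto
    fix z :: complex assume "z \<in> ball 0 1"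
    from N [OF this] show "\<beta> qK z = \<alpha> qRe z * p3 z + \<alpha> qI z * p2 z - \<alpha> qJ z * p1 z + \<alpha> qK z * p0 z"
      by (simp add: p0_def p1_def p2_def p3_def divide_simps) (simp add: N_def, algebra)
  qed (intro exp, simp)
  \<comment> \<open>Since \<open>a 0 = 1\<close>, the \<open>n\<close>-th coefficients of
    \<open>e0\<close> to \<open>e3\<close> express those of \<open>F0\<close> to \<open>F3\<close>
    through real data and earlier coefficients.\<close>
  have real: "fps_nth F0 n \<in> \<real> \<and> fps_nth F1 n \<in> \<real> \<and> fps_nth F2 n \<in> \<real> \<and> fps_nth F3 n \<in> \<real>" for n
  proof (induction n rule: less_induct)
    case (less n)
    have *: "fps_nth (?a c * F) n - of_real (c 1) * fps_nth F n \<in> \<real>"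
      if "F \<in> {F0, F1, F2, F3}" for c F
      using fps_mult_nth_Reals [of "?a c" n F] less that by (auto simp: a0)
    have R: "fps_nth (?a qRe * F) n - fps_nth F n \<in> \<real>" "fps_nth (?a qI * F) n \<in> \<real>"
      "fps_nth (?a qJ * F) n \<in> \<real>" "fps_nth (?a qK * F) n \<in> \<real>" if "F \<in> {F0, F1, F2, F3}" for F
      using * [OF that, of qRe] * [OF that, of qI] * [OF that, of qJ] * [OF that, of qK] by simp_all
    from arg_cong [OF e0, of "\<lambda>F. Im (fps_nth F n)"] arg_cong [OF e1, of "\<lambda>F. Im (fps_nth F n)"]
      arg_cong [OF e2, of "\<lambda>F. Im (fps_nth F n)"] arg_cong [OF e3, of "\<lambda>F. Im (fps_nth F n)"]
      R [of F0] R [of F1] R [of F2] R [of F3]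
    show ?case by (simp add: complex_is_Real_iff)
  qed
  define P where "P n = Quat (Re (fps_nth F0 n)) (Re (fps_nth F1 n)) (Re (fps_nth F2 n))
    (Re (fps_nth F3 n))" for n
  have FP: "F0 = quat_fps qRe P" "F1 = quat_fps qI P" "F2 = quat_fps qJ P" "F3 = quat_fps qK P"
    using real by (simp_all add: fps_eq_iff P_def)
  have mult: "b n = (\<Sum>j=0..n. a j * P (n - j))" for n
  proof -
    have nth: "fps_nth (quat_fps c a * quat_fps d P) n =
      of_real (\<Sum>j=0..n. c (a j) * d (P (n - j)))" for c d
      by (simp add: fps_mult_nth)
    note [simp] = bounded_linear_quat_components
      [THEN bounded_linear.linear, THEN linear_sum]
    show ?thesis
      using arg_cong [OF e0, of "\<lambda>F. fps_nth F n"] arg_cong [OF e1, of "\<lambda>F. fps_nth F n"]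
        arg_cong [OF e2, of "\<lambda>F. fps_nth F n"] arg_cong [OF e3, of "\<lambda>F. fps_nth F n"]
      unfolding FP
      by (simp add: nth quat_eq_iff sum.distrib sum_subtractf del: of_real_sum of_real_mult
          flip: of_real_add of_real_diff)
  qed
  have P0: "P 0 = 1" using mult [of 0] by (simp add: a0 b0)
  have "norm (P n) \<le> 2" if n: "0 < n" for n
  proof -
    \<comment> \<open>The unit \<open>I\<close> is adapted to \<open>P n\<close>. The function
      \<open>f\<close> below has as real part the real part of the quotient evaluated at
      \<open>I\<close>, and its \<open>n\<close>-th coefficient is \<open>w\<close>, of the same
      modulus as \<open>P n\<close>.\<close>
    obtain I w where I: "I \<in> imag_units" and Pw: "P n = slice_emb I w" by (rule slice_emb_exists)
    define f where "f z = p0 z + \<i> * (of_real (qI I) * p1 z + of_real (qJ I) * p2 z +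
      of_real (qK I) * p3 z)" for z
    define F where "F = F0 + fps_const \<i> * (fps_const (of_real (qI I)) * F1 +
      fps_const (of_real (qJ I)) * F2 + fps_const (of_real (qK I)) * F3)"
    have f_exp: "f has_fps_expansion F"
      unfolding f_def F_def by (intro fps_expansion_intros p_exp)
    have I2: "qRe I = 0" "(qI I)\<^sup>2 + (qJ I)\<^sup>2 + (qK I)\<^sup>2 = 1"
      using I by (auto simp: norm_quat_def imag_units_iff)
    have "norm ((deriv ^^ n) f 0 / fact n) \<le> 2 * Re (f 0)"
    proof (rule Caratheodory_coeff_bound [OF _ _ n])
      show "f holomorphic_on ball 0 1"
        unfolding f_def by (intro holomorphic_intros p_hol)
      show "0 < Re (f z)" if "z \<in> ball 0 1" for z
        using p_pos [OF I that] I2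
        by (simp add: f_def biquat_emb_split biquat_re_def biquat_im_def)
    qed
    moreover have "f 0 = fps_nth F 0" 
      using has_fps_expansion_imp_0_eq_fps_nth_0 [OF f_exp] .
    moreover have "fps_nth F 0 = 1"
      using P0 by (simp add: F_def FP)
    moreover have "(deriv ^^ n) f 0 / fact n = fps_nth F n"
      using fps_nth_fps_expansion [OF f_exp] by simp
    moreover have "fps_nth F n = w"
    proof -
      have "fps_nth F n = Complex (Re w) (Im w * ((qI I)\<^sup>2 + (qJ I)\<^sup>2 + (qK I)\<^sup>2))"
        by (simp add: F_def FP Pw slice_emb_def slice_pt_def of_real_quat I2(1) complex_eq_iff
            power2_eq_square algebra_simps)
      then show ?thesis using I2 by simp
    qed
    ultimately show ?thesis by (simp add: Pw norm_slice_emb [OF I])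
  qed
  with that P0 mult show ?thesis by blast
qed

section \<open>Coefficient bounds and sharpness\<close>

lemma quat_sums_at_0:
  fixes a :: "nat \<Rightarrow> quat"
  assumes "(\<lambda>k. 0 ^ k * a k) sums s" shows "s = a 0"
proof -
  have "(\<lambda>k. 0 ^ k * a k) = (\<lambda>k. if k = 0 then a k else 0)" by auto
  with assms show ?thesis using sums_single [of 0 a] sums_unique2 by metis
qed

text \<open>Applies \<open>slice_quotient_coeffs\<close> to \<open>h(q) / q\<close> and the slice
  derivative of \<open>f\<close>. Dividing by \<open>q\<close> and differentiating both lower the
  index by one, hence the \<open>Suc\<close> in the convolution.\<close>

lemma normalized_quotient_coeffs:
  assumes h: "h \<in> normalized_slice"
    and a: "\<And>q. q \<in> quat_ball \<Longrightarrow> (\<lambda>k. q ^ k * a k) sums h q"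
    and f: "slice_regular f"
    and c: "\<And>q. q \<in> quat_ball \<Longrightarrow> (\<lambda>k. q ^ k * c k) sums f q" and c1: "c 1 = 1"
    and pos: "\<And>q. q \<in> quat_ball \<Longrightarrow> qRe (slice_quotient h f q) > 0"
  obtains P where "a 0 = 0" "a 1 = 1" "P 0 = 1" "\<And>n. 0 < n \<Longrightarrow> norm (P n) \<le> 2"
    "\<And>n. of_nat (Suc n) * c (Suc n) = (\<Sum>j=0..n. a (Suc j) * P (n - j))"
proof -
  have h': "slice_regular h" "h 0 = 0" "slice_deriv h 0 = 1"
    and h_nz: "\<And>q. q \<in> quat_ball \<Longrightarrow> h q = 0 \<longleftrightarrow> q = 0"
    using h unfolding normalized_slice_def by auto
  have ball0: "0 \<in> quat_ball" by (simp add: quat_ball_def)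
  have a0: "a 0 = 0" using quat_sums_at_0 [OF a [OF ball0]] h' by simp
  have a1: "a 1 = 1"
    using quat_sums_at_0 [OF slice_deriv_sums [OF h'(1) a ball0]] h' by simp
  \<comment> \<open>The factor \<open>inverse q\<close> stands on the left, so that inverting
    \<open>A q\<close> gives \<open>inverse (h q) * q\<close>, as in \<open>slice_quotient\<close>;
    the value at 0 is \<open>a 1\<close>.\<close>
  define A where "A q = (if q = 0 then 1 else inverse q * h q)" for q
  have A: "(\<lambda>k. q ^ k * a (Suc k)) sums A q" if q: "q \<in> quat_ball" for q
  proof (cases "q = 0")
    case True
    have "(\<lambda>k. 0 ^ k * a (Suc k)) = (\<lambda>k. if k = 0 then a (Suc k) else 0)" by auto
    then show ?thesis using sums_single [of 0 "\<lambda>k. a (Suc k)"] a1 True by (simp add: A_def)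
  next
    case False
    have "(\<lambda>k. q ^ Suc k * a (Suc k)) sums h q"
      using a [OF q] a0 by (subst sums_Suc_iff) simp
    from sums_mult [OF this, of "inverse q"] show ?thesis
      using False by (simp add: A_def flip: mult.assoc)
  qed
  have A_nz: "A q \<noteq> 0" if "q \<in> quat_ball" for q
    using h_nz [OF that] by (simp add: A_def)
  have A_pos: "qRe (inverse (A q) * slice_deriv f q) > 0" if "q \<in> quat_ball" for q
    using pos [OF that] h_nz [OF that]
    by (auto simp: A_def slice_quotient_def nonzero_inverse_mult_distrib split: if_splits)
  from slice_quotient_coeffs [OF A _ slice_deriv_sums [OF f c] _ A_nz A_pos]
  obtain P where "P 0 = 1" "\<And>n. 0 < n \<Longrightarrow> norm (P n) \<le> 2"
    "\<And>n. of_nat (Suc n) * c (Suc n) = (\<Sum>j=0..n. a (Suc j) * P (n - j))"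
    using a1 c1 by auto
  with that a0 a1 show ?thesis by blast
qed

lemma real_sum_Suc: "(\<Sum>j<n. real (Suc j)) = real n * real (Suc n) / 2"
  by (induction n) (auto simp: field_simps)

lemma quotient_sum_bound:
  fixes a P :: "nat \<Rightarrow> quat"
  assumes "\<And>j. j < n \<Longrightarrow> norm (a (Suc j)) \<le> Suc j" "\<And>m. 0 < m \<Longrightarrow> norm (P m) \<le> 2"
  shows "norm (\<Sum>j<n. a (Suc j) * P (n - j)) \<le> real n * real (Suc n)"
proof -
  have "norm (\<Sum>j<n. a (Suc j) * P (n - j)) \<le> (\<Sum>j<n. real (Suc j) * 2)"
    by (intro order_trans [OF norm_sum] sum_mono)
      (auto simp: norm_mult simp del: of_nat_Suc intro!: mult_mono assms)
  also have "\<dots> = real n * real (Suc n)"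
    by (simp add: real_sum_Suc flip: sum_distrib_right del: of_nat_Suc)
  finally show ?thesis .
qed

text \<open>With \<open>f = h\<close> the last term of the convolution is \<open>a (Suc n)\<close>
  itself, because \<open>P 0 = 1\<close>. Subtracting it leaves \<open>n * a (Suc n)\<close> in
  terms of earlier coefficients, whose bounds add up to \<open>n * Suc n\<close>.\<close>

lemma slice_starlike_coeff_bound:
  assumes h: "h \<in> slice_starlike"
    and a: "\<And>q. q \<in> quat_ball \<Longrightarrow> (\<lambda>k. q ^ k * a k) sums h q"
  shows "norm (a n) \<le> n"
proof -
  have h': "h \<in> normalized_slice" "slice_regular h" "slice_deriv h 0 = 1"
    "\<And>q. q \<in> quat_ball \<Longrightarrow> qRe (slice_quotient h h q) > 0"
    using h unfolding slice_starlike_def normalized_slice_def by auto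
  have "0 \<in> quat_ball" by (simp add: quat_ball_def)
  from quat_sums_at_0 [OF slice_deriv_sums [OF h'(2) a this]] h'(3) have a1: "a 1 = 1" by simp
  obtain P where P: "a 0 = 0" "P 0 = 1" "\<And>n. 0 < n \<Longrightarrow> norm (P n) \<le> 2"
    "\<And>n. of_nat (Suc n) * a (Suc n) = (\<Sum>j=0..n. a (Suc j) * P (n - j))"
    using normalized_quotient_coeffs [OF h'(1) a h'(2) a a1 h'(4)] by metis
  have "norm (a (Suc n)) \<le> Suc n" for n
  proof (induction n rule: less_induct)
    case (less n)
    show ?case
    proof (cases "n = 0")
      case True
      then show ?thesis using a1 by simp
    next
      case False
      have "of_nat (Suc n) * a (Suc n) = (\<Sum>j<n. a (Suc j) * P (n - j)) + a (Suc n)"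
        unfolding P(4) atLeast0AtMost
        by (simp add: P flip: lessThan_Suc_atMost)
      then have "of_nat n * a (Suc n) = (\<Sum>j<n. a (Suc j) * P (n - j))"
        by (simp add: distrib_right)
      then have "norm (of_nat n * a (Suc n)) \<le> real n * real (Suc n)"
        using quotient_sum_bound [of n a P] less P(3) by simp
      then show ?thesis using False by (simp add: norm_mult)
    qed
  qed
  with P(1) show ?thesis by (cases n) auto
qed

text \<open>The starlike bound replaces the induction: the terms with \<open>j < n\<close>
  contribute \<open>n * Suc n\<close> and the last one \<open>Suc n\<close>, in total the square of
  \<open>Suc n\<close>.\<close>

lemma slice_close_to_convex_coeff_bound:
  assumes f: "f \<in> slice_close_to_convex"
    and c: "\<And>q. q \<in> quat_ball \<Longrightarrow> (\<lambda>k. q ^ k * c k) sums f q" and c1: "c 1 = 1"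
  shows "norm (c (Suc n)) \<le> Suc n"
proof -
  obtain h where h: "h \<in> slice_starlike" "slice_regular f"
    "\<And>q. q \<in> quat_ball \<Longrightarrow> qRe (slice_quotient h f q) > 0"
    using f unfolding slice_close_to_convex_def by auto
  have hn: "h \<in> normalized_slice" "slice_regular h"
    using h(1) by (auto simp: slice_starlike_def normalized_slice_def)
  obtain a where a: "\<And>q. q \<in> quat_ball \<Longrightarrow> (\<lambda>k. q ^ k * a k) sums h q"
    using slice_regular_power_series [OF hn(2)] by blast
  note a_bound = slice_starlike_coeff_bound [OF h(1) a]
  obtain P where P: "P 0 = 1" "\<And>n. 0 < n \<Longrightarrow> norm (P n) \<le> 2"
    "\<And>n. of_nat (Suc n) * c (Suc n) = (\<Sum>j=0..n. a (Suc j) * P (n - j))"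
    using normalized_quotient_coeffs [OF hn(1) a h(2) c c1 h(3)] by metis
  have "of_nat (Suc n) * c (Suc n) = (\<Sum>j<n. a (Suc j) * P (n - j)) + a (Suc n)"
    unfolding P(3) atLeast0AtMost by (simp add: P flip: lessThan_Suc_atMost)
  then have "norm (of_nat (Suc n) * c (Suc n)) \<le> real n * real (Suc n) + real (Suc n)"
    using quotient_sum_bound [of n a P, OF a_bound P(2)] a_bound [of "Suc n"]
    by (simp del: of_nat_Suc) (metis add_mono norm_triangle_le)
  also have "\<dots> = real (Suc n) * real (Suc n)" by (simp add: algebra_simps)
  also have "norm (of_nat (Suc n) * c (Suc n)) = real (Suc n) * norm (c (Suc n))"
    by (simp add: norm_mult del: of_nat_Suc)
  finally show ?thesis by (simp del: of_nat_Suc)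
qed

section \<open>The Koebe series and the critical radius\<close>

lemma sums_koebe:
  fixes z :: "'a :: {real_normed_field, banach}"
  assumes "norm z < 1"
  shows "(\<lambda>k. z ^ (k + 2) * of_nat (k + 2)) sums (z / (1 - z)\<^sup>2 - z)"
proof -
  have "(\<lambda>k. z * (of_nat (Suc k) * z ^ k)) sums (z * (1 / (1 - z)\<^sup>2))"
    by (intro sums_mult geometric_deriv_sums assms)
  then have "(\<lambda>k. z ^ (k + 1) * of_nat (k + 1)) sums (z / (1 - z)\<^sup>2)"
    by (simp add: mult_ac)
  then show ?thesis
    using sums_Suc_iff [of "\<lambda>k. z ^ (k + 1) * of_nat (k + 1)" "z / (1 - z)\<^sup>2 - z"] by simp
qed

text \<open>The roots of \<open>(1 - r)^2 - r\<close> are \<open>s = (3 - sqrt 5) / 2\<close> and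
  \<open>3 - s\<close>; the second exceeds 1, so only \<open>s\<close> decides the sign.\<close>

lemma koebe_le_1_iff:
  fixes r :: real
  assumes "0 \<le> r" "r < 1"
  shows "r / (1 - r)\<^sup>2 \<le> 1 \<longleftrightarrow> r \<le> (3 - sqrt 5) / 2"
proof -
  define s where "s = (3 - sqrt 5) / 2"
  have "(1 - r)\<^sup>2 - r = (s - r) * (3 - s - r)"
    by (simp add: s_def field_simps power2_eq_square)
  moreover have "3 - s - r > 0"
  proof -
    have "0 < sqrt 5" by simp
    with assms have "r * 2 < 3 + sqrt 5" by linarith
    then show ?thesis by (simp add: s_def field_simps)
  qed
  ultimately have "(1 - r)\<^sup>2 - r \<ge> 0 \<longleftrightarrow> s - r \<ge> 0" by (simp add: zero_le_mult_iff)
  then show ?thesis using assms by (simp add: s_def)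
qed

lemma slice_close_to_convex_bohr:
  assumes f: "f \<in> slice_close_to_convex" and p: "has_normalized_expansion f p"
    and q: "q \<in> quat_ball" and r: "norm q \<le> (3 - sqrt 5) / 2"
  shows "bohr_inequality p q"
proof -
  \<comment> \<open>\<open>has_normalized_expansion\<close> says nothing about \<open>p 0\<close>
    and \<open>p 1\<close>, so the true coefficients 0 and 1 are put in their place.\<close>
  define c where "c k = (if k = 0 then 0 else if k = 1 then 1 else p k)" for k
  have c: "(\<lambda>k. q ^ k * c k) sums f q" if "q \<in> quat_ball" for q
  proof -
    have "(\<lambda>k. q ^ (k + 2) * c (k + 2)) sums (f q - q)"
      using p that by (simp add: has_normalized_expansion_def c_def)
    then have "(\<lambda>k. q ^ (k + 1) * c (k + 1)) sums f q"
      using sums_Suc_iff [of "\<lambda>k. q ^ (k + 1) * c (k + 1)"] by (simp add: c_def)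
    then show ?thesis
      using sums_Suc_iff [of "\<lambda>k. q ^ k * c k"] by (simp add: c_def)
  qed
  have bound: "norm (p (k + 2)) \<le> k + 2" for k
    using slice_close_to_convex_coeff_bound [OF f c, of "Suc k"] by (simp add: c_def)
  have q1: "norm q < 1" using q by (simp add: quat_ball_def)
  have koebe: "(\<lambda>k. norm q ^ (k + 2) * of_nat (k + 2)) sums (norm q / (1 - norm q)\<^sup>2 - norm q)"
    using sums_koebe [of "norm q"] q1 by simp
  have le: "norm (q ^ (k + 2) * p (k + 2)) \<le> norm q ^ (k + 2) * of_nat (k + 2)" for k
    unfolding norm_mult norm_power by (intro mult_left_mono bound) simp
  have summable: "summable (\<lambda>k. norm (q ^ (k + 2) * p (k + 2)))"
    by (rule summable_comparison_test [OF _ sums_summable [OF koebe]])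
      (use le in \<open>simp del: power_Suc\<close>)
  have "(\<Sum>k. norm (q ^ (k + 2) * p (k + 2))) \<le> norm q / (1 - norm q)\<^sup>2 - norm q"
    using suminf_le [OF le summable sums_summable [OF koebe]] sums_unique [OF koebe] by simp
  also have "\<dots> \<le> 1 - norm q" using koebe_le_1_iff [of "norm q"] q1 r by simp
  finally show ?thesis using summable by (simp add: bohr_inequality_def)
qed

section \<open>The Koebe function as an extremal starlike function\<close>

definition quat_koebe :: "quat \<Rightarrow> quat" where
  "quat_koebe q = q * inverse ((1 - q)\<^sup>2)"

text \<open>A rational function with real coefficients preserves every slice, so all questions about
  it reduce to the complex Koebe function.\<close>

lemma quat_koebe_emb:
  assumes "I \<in> imag_units"
  shows "quat_koebe (slice_emb I z) = slice_emb I (z / (1 - z)\<^sup>2)"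
  by (simp add: quat_koebe_def divide_inverse slice_emb_mult [OF assms]
      slice_emb_inverse [OF assms] slice_emb_power [OF assms] slice_emb_diff)

lemma quat_koebe_derivs:
  assumes I: "I \<in> imag_units" and xy: "slice_pt I x y \<in> quat_ball"
  defines "d \<equiv> (1 + Complex x y) / (1 - Complex x y) ^ 3"
  shows "((\<lambda>s. quat_koebe (slice_pt I s y)) has_vector_derivative slice_emb I d) (at x)"
    and "((\<lambda>t. quat_koebe (slice_pt I x t)) has_vector_derivative slice_emb I (\<i> * d)) (at y)"
proof -
  have "norm (Complex x y) < 1" using xy by (simp add: slice_pt_eq_emb slice_emb_in_ball [OF I])
  then have "1 - Complex x y \<noteq> 0" by (metis eq_iff_diff_eq_0 less_irrefl norm_one)
  then have "((\<lambda>z. z / (1 - z)\<^sup>2) has_field_derivative d) (at (Complex x y))"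
    unfolding d_def
    by (auto intro!: derivative_eq_intros simp: divide_simps) algebra
  from has_vector_derivative_slice_emb [OF this]
  show "((\<lambda>s. quat_koebe (slice_pt I s y)) has_vector_derivative slice_emb I d) (at x)"
    and "((\<lambda>t. quat_koebe (slice_pt I x t)) has_vector_derivative slice_emb I (\<i> * d)) (at y)"
    by (simp_all add: slice_pt_eq_emb quat_koebe_emb [OF I])
qed

lemma slice_regular_quat_koebe: "slice_regular quat_koebe"
  unfolding slice_regular_def
proof (intro ballI conjI allI impI)
  fix I assume I: "I \<in> imag_units"
  let ?U = "{(x, y). slice_pt I x y \<in> quat_ball}"
  let ?d = "\<lambda>x y. (1 + Complex x y) / (1 - Complex x y) ^ 3"
  note D = quat_koebe_derivs [OF I]
  have dxy: "slice_dx quat_koebe I x y = slice_emb I (?d x y)"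
    "slice_dy quat_koebe I x y = slice_emb I (\<i> * ?d x y)" if "slice_pt I x y \<in> quat_ball" for x y
    unfolding slice_dx_def slice_dy_def using D [OF that] by (auto intro: vector_derivative_at)
  show "(\<lambda>s. quat_koebe (slice_pt I s y)) differentiable at x"
    "(\<lambda>t. quat_koebe (slice_pt I x t)) differentiable at y"
    if "slice_pt I x y \<in> quat_ball" for x y
    using D [OF that] by (auto intro: differentiableI_vector)
  have nz: "1 - Complex x y \<noteq> 0" if "slice_pt I x y \<in> quat_ball" for x y
  proof -
    have "norm (Complex x y) < 1"
      using that by (simp add: slice_pt_eq_emb slice_emb_in_ball [OF I])
    then show ?thesis by (metis eq_iff_diff_eq_0 less_irrefl norm_one)
  qed
  have cont: "continuous_on ?U (\<lambda>p. ?d (fst p) (snd p))"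
    using nz by (auto simp: Complex_eq intro!: continuous_intros)
  have "continuous_on ?U (\<lambda>p. slice_emb I (?d (fst p) (snd p)))"
    by (intro bounded_linear.continuous_on [OF bounded_linear_slice_emb] cont)
  then show "continuous_on ?U (\<lambda>(x, y). slice_dx quat_koebe I x y)"
    by (rule continuous_on_eq) (auto simp: dxy)
  have "continuous_on ?U (\<lambda>p. slice_emb I (\<i> * ?d (fst p) (snd p)))"
    by (intro bounded_linear.continuous_on [OF bounded_linear_slice_emb] continuous_intros cont)
  then show "continuous_on ?U (\<lambda>(x, y). slice_dy quat_koebe I x y)"
    by (rule continuous_on_eq) (auto simp: dxy)
  show "(1 / 2) *\<^sub>R (slice_dx quat_koebe I x y + I * slice_dy quat_koebe I x y) = 0"
    if "slice_pt I x y \<in> quat_ball" for x y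
    using imag_units_square [OF I]
    unfolding dxy [OF that] slice_emb_mult [OF I, of \<i>] by (simp flip: mult.assoc)
qed

lemma slice_deriv_quat_koebe:
  assumes I: "I \<in> imag_units" and z: "z \<in> ball 0 1"
  shows "slice_deriv quat_koebe (slice_emb I z) = slice_emb I ((1 + z) / (1 - z) ^ 3)"
proof -
  have xy: "slice_pt I (Re z) (Im z) \<in> quat_ball"
    using z slice_emb_in_ball [OF I] by (simp add: slice_emb_def)
  show ?thesis
    using slice_deriv_eq [OF slice_regular_quat_koebe I xy]
      slice_deriv_eq_dx [OF slice_regular_quat_koebe I xy]
      vector_derivative_at [OF quat_koebe_derivs(1) [OF I xy]]
    by (simp add: slice_dx_def flip: slice_emb_def)
qed

text \<open>On each slice the quotient becomes \<open>(1 + z) / (1 - z)\<close>, which maps the unit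
  disc into the right half-plane.\<close>

lemma quat_koebe_starlike: "quat_koebe \<in> slice_starlike"
proof -
  obtain I0 where I0: "I0 \<in> imag_units" using imag_units_exists by blast
  have deriv0: "slice_deriv quat_koebe 0 = 1"
    using slice_deriv_quat_koebe [OF I0, of 0] by simp
  have zeros: "quat_koebe q = 0 \<longleftrightarrow> q = 0" if "q \<in> quat_ball" for q
    using that by (auto simp: quat_koebe_def quat_ball_def)
  have "qRe (slice_quotient quat_koebe quat_koebe q) > 0" if "q \<in> quat_ball" for q
  proof (cases "q = 0")
    case True
    then show ?thesis by (simp add: slice_quotient_def deriv0)
  next
    case False
    obtain I z where I: "I \<in> imag_units" and qz: "q = slice_emb I z" by (rule slice_emb_exists)
    have z: "z \<in> ball 0 1" using that by (simp add: qz slice_emb_in_ball [OF I])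
    have z0: "z \<noteq> 0" "1 - z \<noteq> 0" using z False by (auto simp: qz)
    have "slice_quotient quat_koebe quat_koebe q =
        slice_emb I (inverse (z / (1 - z)\<^sup>2) * z * ((1 + z) / (1 - z) ^ 3))"
      using False slice_deriv_quat_koebe [OF I z]
      by (simp add: slice_quotient_def qz quat_koebe_emb [OF I] slice_emb_mult [OF I]
          slice_emb_inverse [OF I] del: inverse_divide times_divide_eq_right)
    also have "inverse (z / (1 - z)\<^sup>2) * z * ((1 + z) / (1 - z) ^ 3) = (1 + z) / (1 - z)"
      using z0 by (simp add: divide_simps power2_eq_square power3_eq_cube)
    finally have "qRe (slice_quotient quat_koebe quat_koebe q) = Re ((1 + z) / (1 - z))"
      using I by (simp add: slice_emb_def slice_pt_def of_real_quat imag_units_iff)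
    also have "\<dots> = (1 - (norm z)\<^sup>2) / (norm (1 - z))\<^sup>2"
      unfolding cmod_power2 by (simp add: Re_divide power2_eq_square algebra_simps)
    also have "\<dots> > 0"
      using z z0 by (intro divide_pos_pos) (auto simp: power_less_one_iff)
    finally show ?thesis .
  qed
  moreover have "quat_koebe 0 = 0" "0 \<in> quat_ball" by (simp_all add: quat_koebe_def quat_ball_def)
  ultimately show ?thesis
    using slice_regular_quat_koebe deriv0 zeros
    unfolding slice_starlike_def normalized_slice_def by auto
qed

lemma quat_koebe_expansion: "has_normalized_expansion quat_koebe of_nat"
  unfolding has_normalized_expansion_def
proof
  fix q assume q: "q \<in> quat_ball"
  obtain I z where I: "I \<in> imag_units" and qz: "q = slice_emb I z" by (rule slice_emb_exists)
  have "norm z < 1" using q by (simp add: qz slice_emb_in_ball [OF I])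
  from bounded_linear.sums [OF bounded_linear_slice_emb sums_koebe [OF this], of I]
  have "(\<lambda>k. slice_emb I (z ^ (k + 2)) * slice_emb I (of_nat (k + 2))) sums
      (quat_koebe q - q)"
    by (simp only: slice_emb_mult [OF I] slice_emb_diff quat_koebe_emb [OF I] qz)
  then show "(\<lambda>k. q ^ (k + 2) * of_nat (k + 2)) sums (quat_koebe q - q)"
    by (simp only: slice_emb_power [OF I] slice_emb_of_nat qz)
qed

theorem theorem1p3:
  "(\<forall>f p. f \<in> slice_close_to_convex \<and> has_normalized_expansion f p \<longrightarrow>
      (\<forall>q\<in>quat_ball. norm q \<le> (3 - sqrt 5) / 2 \<longrightarrow> bohr_inequality p q)) \<and>
   (\<forall>R>(3 - sqrt 5) / 2.
      \<not> (\<forall>f p. f \<in> slice_close_to_convex \<and> has_normalized_expansion f p \<longrightarrow>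
           (\<forall>q\<in>quat_ball. norm q \<le> R \<longrightarrow> bohr_inequality p q)))"
proof (intro conjI allI impI notI)
  show "\<forall>q\<in>quat_ball. norm q \<le> (3 - sqrt 5) / 2 \<longrightarrow> bohr_inequality p q"
    if "f \<in> slice_close_to_convex \<and> has_normalized_expansion f p" for f p
    using that slice_close_to_convex_bohr by blast
next
  fix R :: real
  assume R: "(3 - sqrt 5) / 2 < R"
    and all: "\<forall>f p. f \<in> slice_close_to_convex \<and> has_normalized_expansion f p \<longrightarrow>
           (\<forall>q\<in>quat_ball. norm q \<le> R \<longrightarrow> bohr_inequality p q)"
  have "1 < sqrt 5" "sqrt 5 < 3" by (simp_all add: real_less_rsqrt real_less_lsqrt)
  then have "(3 - sqrt 5) / 2 < min R 1" using R by simp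
  \<comment> \<open>\<open>R\<close> may be 1 or more, while the test point must stay inside the
    ball.\<close>
  then obtain r where r: "(3 - sqrt 5) / 2 < r" "r < min R 1" using dense by blast
  then have r0: "0 \<le> r" "r < 1" using \<open>sqrt 5 < 3\<close> by auto
  \<comment> \<open>A starlike function is its own witness \<open>h\<close>.\<close>
  have "quat_koebe \<in> slice_close_to_convex"
    using quat_koebe_starlike unfolding slice_close_to_convex_def
    by (auto simp: slice_regular_quat_koebe slice_starlike_def intro!: bexI [of _ quat_koebe])
  moreover have "of_real r \<in> quat_ball" "norm (of_real r :: quat) \<le> R"
    using r r0 by (simp_all add: quat_ball_def)
  ultimately have "bohr_inequality of_nat (of_real r)"
    using all quat_koebe_expansion by blast
  then have "r + (\<Sum>k. r ^ (k + 2) * real (k + 2)) \<le> 1"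
    unfolding bohr_inequality_def norm_mult norm_power norm_of_nat using r0 by simp
  \<comment> \<open>At a nonnegative real point all terms are nonnegative, so the sum of norms is
    the Koebe value itself, which exceeds 1 beyond the critical radius.\<close>
  also have "(\<Sum>k. r ^ (k + 2) * real (k + 2)) = r / (1 - r)\<^sup>2 - r"
    using sums_koebe [of r] r0 by (intro sums_unique [symmetric]) simp
  finally show False using koebe_le_1_iff [OF r0] r by simp
qed

end
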